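(* Let $\Omega_1\subset\Omega$ be domains in $\mathbb{R}^n$ $(n\ge 3)$ with $\overline\Omega_1$ compact, and let $\omega\subset b\Omega\cap b\Omega_1$ be such that for some $\delta>0$ we have $\mathbb{B}(\mathbf{p},\delta)\cap\Omega\subset\Omega_1$ for all $\mathbf{p}\in\omega$. Assume that for every $\mathbf{p}\in\omega$ there exists a continuous function $u_{\mathbf{p}}:\overline\Omega_1\to(-\infty,0]$, which is MPSH on $\Omega_1$, such that $u_{\mathbf{p}}(\mathbf{p})=0$, $u_{\mathbf{p}}<0$ on $\overline\Omega_1\setminus\{\mathbf{p}\}$, and $$c_0|u_{\mathbf{p}}(\mathbf{x})|\le|\mathbf{x}-\mathbf{p}|\le\phi(|u_{\mathbf{p}}(\mathbf{x})|),\quad \mathbf{x}\in\Omega_1,\ \mathbf{p}\in\omega$$ for some $c_0>0$ and a continuous increasing function $\phi:\mathbb{R}_+\to\mathbb{R}_+$ with $\phi(0)=0$, where the constant $c_0$ and the function $\phi$ are independent of $\mathbf{p}\in\omega$. Then there is $c>0$ such that $$g_\Omega(\mathbf{x},\mathbf{v})\ge(1-c\,\mathrm{dist}(\mathbf{x},\omega))\,g_{\Omega_1}(\mathbf{x},\mathbf{v}),\quad \mathbf{x}\in\Omega_1,\ \mathbf{v}\in\mathbb{R}^n.$$ In particular, $\Omega$ is hyperbolic at every point (of $\Omega$) close enough to $\omega$.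
   Context: A domain is a nonempty connected open set; $b\Omega$ is the topological boundary; $\mathbb{B}(\mathbf{p},r)$ is the open Euclidean ball of radius $r$ centred at $\mathbf{p}$; $\mathbb{R}_+=[0,+\infty)$; $\mathrm{dist}(\mathbf{x},\omega)$ is the Euclidean distance. $\mathbb{D}=\{z=x+iy\in\mathbb{C}:|z|<1\}$. A $C^1$ map $f$ from an open subset of $\mathbb{R}^2=\mathbb{C}$ to $\mathbb{R}^n$ is conformal if $|f_x|=|f_y|$ and $f_x\cdot f_y=0$ at every point (it need not be an immersion). $\mathrm{CH}(\mathbb{D},\Omega)$ denotes the set of all conformal harmonic maps $\mathbb{D}\to\Omega$, and the minimal pseudometric is $$g_\Omega(\mathbf{x},\mathbf{v})=\inf\{1/r>0:\exists f\in \mathrm{CH}(\mathbb{D},\Omega),\ f(0)=\mathbf{x},\ f_x(0)=r\mathbf{v}\},\quad \mathbf{x}\in\Omega,\ \mathbf{v}\in\mathbb{R}^n.$$ $\Omega$ is hyperbolic at a point $\mathbf{p}\in\Omega$ if there are a neighbourhood $U\subset\Omega$ of $\mathbf{p}$ and a constant $c>0$ such that $g_\Omega(\mathbf{x},\mathbf{u})\ge c|\mathbf{u}|$ for all $\mathbf{x}\in U$, $\mathbf{u}\in\mathbb{R}^n$. An upper-semicontinuous function $u:\Omega_1\to[-\infty,+\infty)$ is minimal plurisubharmonic (MPSH) if for every affine $2$-plane $L\subset\mathbb{R}^n$ the restriction of $u$ to $L\cap\Omega_1$ is subharmonic in conformal linear coordinates on $L$. *)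

theory Defs
  imports "HOL-Analysis.Analysis"
begin

definition is_domain :: "'a::euclidean_space set \<Rightarrow> bool" where
  "is_domain S \<longleftrightarrow> S \<noteq> {} \<and> connected S \<and> open S"

text \<open>Partial derivatives with respect to \<open>x\<close> and \<open>y\<close>, where \<open>z = x + \<i> y\<close>; they are meaningful only
  where the map is (totally) differentiable.\<close>

definition pdx :: "(complex \<Rightarrow> 'b::real_normed_vector) \<Rightarrow> complex \<Rightarrow> 'b" where
  "pdx f z = frechet_derivative f (at z) 1"

definition pdy :: "(complex \<Rightarrow> 'b::real_normed_vector) \<Rightarrow> complex \<Rightarrow> 'b" where
  "pdy f z = frechet_derivative f (at z) \<i>"

definition C1_on :: "complex set \<Rightarrow> (complex \<Rightarrow> 'b::real_normed_vector) \<Rightarrow> bool" where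
  "C1_on D f \<longleftrightarrow> (\<forall>z\<in>D. f differentiable (at z)) \<and> continuous_on D (pdx f) \<and> continuous_on D (pdy f)"

definition C2_on :: "complex set \<Rightarrow> (complex \<Rightarrow> 'b::real_normed_vector) \<Rightarrow> bool" where
  "C2_on D f \<longleftrightarrow> C1_on D f \<and> C1_on D (pdx f) \<and> C1_on D (pdy f)"

definition harmonic_on :: "complex set \<Rightarrow> (complex \<Rightarrow> 'b::real_normed_vector) \<Rightarrow> bool" where
  "harmonic_on D f \<longleftrightarrow> C2_on D f \<and> (\<forall>z\<in>D. pdx (pdx f) z + pdy (pdy f) z = 0)"

definition conformal_on :: "complex set \<Rightarrow> (complex \<Rightarrow> 'b::real_inner) \<Rightarrow> bool" where
  "conformal_on D f \<longleftrightarrow>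
     C1_on D f \<and> (\<forall>z\<in>D. norm (pdx f z) = norm (pdy f z) \<and> pdx f z \<bullet> pdy f z = 0)"

definition CH :: "complex set \<Rightarrow> 'a::euclidean_space set \<Rightarrow> (complex \<Rightarrow> 'a) set" where
  "CH D \<Omega> = {f. conformal_on D f \<and> harmonic_on D f \<and> f ` D \<subseteq> \<Omega>}"

text \<open>The infimum is taken in \<open>real\<close>. This is harmless for \<open>x \<in> \<Omega>\<close> with \<open>\<Omega>\<close> open in dimension at least
  2: the set is bounded below by 0, and it is nonempty because of small flat discs through \<open>x\<close>.\<close>

definition minimal_pseudometric :: "'a::euclidean_space set \<Rightarrow> 'a \<Rightarrow> 'a \<Rightarrow> real" where
  "minimal_pseudometric \<Omega> x v =
     Inf {1 / r | r. 1 / r > 0 \<and> (\<exists>f \<in> CH (ball 0 1) \<Omega>. f 0 = x \<and> pdx f 0 = r *\<^sub>R v)}"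

definition hyperbolic_at :: "'a::euclidean_space set \<Rightarrow> 'a \<Rightarrow> bool" where
  "hyperbolic_at \<Omega> p \<longleftrightarrow>
     (\<exists>U c. open U \<and> p \<in> U \<and> U \<subseteq> \<Omega> \<and> c > 0 \<and>
        (\<forall>x\<in>U. \<forall>u. minimal_pseudometric \<Omega> x u \<ge> c * norm u))"

definition usc_on :: "'a::topological_space set \<Rightarrow> ('a \<Rightarrow> ereal) \<Rightarrow> bool" where
  "usc_on S u \<longleftrightarrow> (\<forall>x\<in>S. \<forall>c > u x. \<forall>\<^sub>F y in at x within S. u y < c)"

text \<open>Subharmonicity in the plane by comparison with harmonic majorants on discs; the function
  identically \<open>-\<infinity>\<close> is allowed.\<close>

definition subharmonic_on :: "complex set \<Rightarrow> (complex \<Rightarrow> ereal) \<Rightarrow> bool" where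
  "subharmonic_on D u \<longleftrightarrow>
     (\<forall>z\<in>D. u z < \<infinity>) \<and> usc_on D u \<and>
     (\<forall>a r. \<forall>h :: complex \<Rightarrow> real. r > 0 \<and> cball a r \<subseteq> D \<and>
        continuous_on (cball a r) h \<and> harmonic_on (ball a r) h \<and>
        (\<forall>z\<in>sphere a r. u z \<le> ereal (h z)) \<longrightarrow>
        (\<forall>z\<in>ball a r. u z \<le> ereal (h z)))"

text \<open>Conformal linear coordinates on an affine 2-plane \<open>L\<close>, given as a parametrization
  \<open>\<psi> : \<complex> \<rightarrow> L\<close>.\<close>

definition conformal_coordinates :: "'a::euclidean_space set \<Rightarrow> (complex \<Rightarrow> 'a) \<Rightarrow> bool" where
  "conformal_coordinates L \<psi> \<longleftrightarrow> range \<psi> = L \<and>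
     (\<exists>a e1 e2. norm e1 = norm e2 \<and> e1 \<noteq> 0 \<and> e1 \<bullet> e2 = 0 \<and>
        (\<forall>z. \<psi> z = a + Re z *\<^sub>R e1 + Im z *\<^sub>R e2))"

definition MPSH_on :: "'a::euclidean_space set \<Rightarrow> ('a \<Rightarrow> ereal) \<Rightarrow> bool" where
  "MPSH_on \<Omega> u \<longleftrightarrow>
     (\<forall>x\<in>\<Omega>. u x < \<infinity>) \<and> usc_on \<Omega> u \<and>
     (\<forall>L. affine L \<and> aff_dim L = 2 \<longrightarrow>
        (\<forall>\<psi>. conformal_coordinates L \<psi> \<longrightarrow> subharmonic_on (\<psi> -` (L \<inter> \<Omega>)) (\<lambda>z. u (\<psi> z))))"

end

theory Submission
  imports Defs "HOL-Real_Asymp.Real_Asymp"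
begin

text \<open>Along a conformal harmonic disc \<open>f\<close>, a continuous MPSH function \<open>u\<close> obeys the maximum principle, even
  after adding functions whose Laplacian along \<open>f\<close> is positive. As \<open>u\<close> is merely continuous, this is
  proved by doubling variables rather than by a chain rule.

  Gluing \<open>u\<^sub>p + \<kappa> |y - p|\<^sup>2\<close> to a constant gives a function on all of \<open>\<Omega>\<close> which is strictly MPSH near \<open>p\<close>.
  Sibony's method then shows that a disc whose value at \<open>z\<^sub>1\<close> is near \<open>p\<close> stays near \<open>p\<close> on a
  pseudohyperbolic disc around \<open>z\<^sub>1\<close> of a fixed radius \<open>\<tau>\<close>, which already gives hyperbolicity. If \<open>f 0\<close> is
  close to \<open>p\<close> but \<open>|f z\<^sub>1 - p| = d\<close>, then the glued function is at most \<open>- \<eta>'\<close> on that disc, and comparison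
  with a multiple of the Green function \<open>ln (pseudohyp z\<^sub>1 z)\<close> gives \<open>1 - |z\<^sub>1| \<le> C |f 0 - p|\<close>. Hence \<open>f\<close> maps
  the disc of radius \<open>1 - c dist (f 0, \<omega>)\<close> into \<open>\<Omega>\<^sub>1\<close>.\<close>

section \<open>Harmonic maps and partial derivatives\<close>

text \<open>The two inequalities on \<open>u\<close> do different work. The modulus
  \<open>\<phi>\<close> only converts distance from \<open>p\<close> into a definite negative bound
  for \<open>u\<close>, whereas the linear bound by \<open>c\<^sub>0\<close> is what makes the final
  estimate linear in |f 0 - p|, and hence produces a radius of the form 1 - c dist. All constants
  come from \<delta>, \<open>c\<^sub>0\<close> and \<phi>, which is why one c serves every p.

  The obstacle in the localization is that a logarithmic pole must be cut off, since
  \<open>u\<close> lives only near p. Along a conformal harmonic disc the cutoff costs a multiple of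
  |f_x|^2, and this is exactly the kind of quantity that \<kappa> |y - p|^2 gains, however large the
  derivative of the disc is; the weights are chosen so that the two cancel.

  The pole is placed at an arbitrary point of the disc by means of the pseudohyperbolic distance, so
  discs need not be recentred by automorphisms. Discs may behave badly at the unit circle. Boundary
  values are therefore replaced by compactness of superlevel sets, forced by small perturbations
  that are removed in the limit.\<close>

definition has_partials :: "(complex \<Rightarrow> 'b::real_normed_vector) \<Rightarrow> 'b \<Rightarrow> 'b \<Rightarrow> complex \<Rightarrow> bool" where
  "has_partials f a b z \<longleftrightarrow> (f has_derivative (\<lambda>w. Re w *\<^sub>R a + Im w *\<^sub>R b)) (at z)"

lemma has_partials_eq:
  assumes "has_partials f a b z"
  shows "f differentiable (at z)" "pdx f z = a" "pdy f z = b"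
proof -
  have d: "(f has_derivative (\<lambda>w. Re w *\<^sub>R a + Im w *\<^sub>R b)) (at z)"
    using assms by (simp add: has_partials_def)
  then show "f differentiable (at z)" by (rule differentiableI)
  have "frechet_derivative f (at z) = (\<lambda>w. Re w *\<^sub>R a + Im w *\<^sub>R b)"
    using frechet_derivative_at[OF d] by simp
  then show "pdx f z = a" "pdy f z = b"
    by (auto simp: pdx_def pdy_def)
qed

lemma differentiable_has_partials:
  assumes "f differentiable (at z)"
  shows "has_partials f (pdx f z) (pdy f z) z"
proof -
  have d: "(f has_derivative frechet_derivative f (at z)) (at z)"
    using assms frechet_derivative_works by blast
  interpret bounded_linear "frechet_derivative f (at z)"
    using d by (rule has_derivative_bounded_linear)
  have "frechet_derivative f (at z) w = Re w *\<^sub>R pdx f z + Im w *\<^sub>R pdy f z" for w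
  proof -
    have "w = Re w *\<^sub>R 1 + Im w *\<^sub>R \<i>"
      by (simp add: complex_eq_iff)
    then have "frechet_derivative f (at z) w = frechet_derivative f (at z) (Re w *\<^sub>R 1 + Im w *\<^sub>R \<i>)"
      by simp
    then show ?thesis
      by (simp add: add scaleR pdx_def pdy_def)
  qed
  then have "frechet_derivative f (at z) = (\<lambda>w. Re w *\<^sub>R pdx f z + Im w *\<^sub>R pdy f z)"
    by blast
  then show ?thesis using d by (simp add: has_partials_def)
qed

lemma has_partials_cong:
  assumes "has_partials f a b z" "open S" "z \<in> S" "\<And>w. w \<in> S \<Longrightarrow> f w = g w"
  shows "has_partials g a b z"
  using assms unfolding has_partials_def
  by (meson has_derivative_transform_within_open)

lemma has_partials_bounded_linear:
  assumes "bounded_linear L" "has_partials f a b z"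
  shows "has_partials (\<lambda>w. L (f w)) (L a) (L b) z"
proof -
  interpret bounded_linear L by fact
  show ?thesis
    using has_derivative[OF assms(2)[unfolded has_partials_def]]
    by (simp add: has_partials_def add scaleR)
qed

lemma has_partials_add:
  assumes "has_partials f a b z" "has_partials g a' b' z"
  shows "has_partials (\<lambda>w. f w + g w) (a + a') (b + b') z"
  using has_derivative_add[OF assms[unfolded has_partials_def]]
  by (simp add: has_partials_def scaleR_add_right add_ac)

lemma has_partials_const: "has_partials (\<lambda>w. c) 0 0 z"
  by (simp add: has_partials_def)

lemma has_partials_scale:
  assumes "has_partials f a b (s *\<^sub>R z)"
  shows "has_partials (\<lambda>w. f (s *\<^sub>R w)) (s *\<^sub>R a) (s *\<^sub>R b) z"
proof -
  have "((\<lambda>w. s *\<^sub>R w) has_derivative (\<lambda>w. s *\<^sub>R w)) (at z)"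
    by (intro derivative_eq_intros) auto
  from has_derivative_compose[OF this assms[unfolded has_partials_def]]
  show ?thesis by (simp add: has_partials_def mult.commute)
qed

lemma has_partials_Re_holomorphic:
  assumes "(F has_field_derivative F') (at z)"
  shows "has_partials (\<lambda>w. Re (F w)) (Re F') (- Im F') z"
proof -
  have "(F has_derivative (\<lambda>w. F' * w)) (at z)"
    using assms by (simp add: has_field_derivative_def)
  from has_derivative_Re[OF this] show ?thesis
    by (simp add: has_partials_def mult.commute)
qed

lemma C1_onI:
  assumes "\<And>z. z \<in> D \<Longrightarrow> has_partials f (a z) (b z) z" "continuous_on D a" "continuous_on D b"
  shows "C1_on D f"
  unfolding C1_on_def
proof (intro conjI)
  show "\<forall>z\<in>D. f differentiable at z" using assms(1) has_partials_eq(1) by blast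
  show "continuous_on D (pdx f)"
    by (rule continuous_on_cong[THEN iffD1, OF refl _ assms(2)])
       (use assms(1) has_partials_eq(2) in fastforce)
  show "continuous_on D (pdy f)"
    by (rule continuous_on_cong[THEN iffD1, OF refl _ assms(3)])
       (use assms(1) has_partials_eq(3) in fastforce)
qed

lemma has_partials_continuous_on:
  assumes "\<And>z. z \<in> D \<Longrightarrow> has_partials f (a z) (b z) z"
  shows "continuous_on D f"
  using assms has_partials_eq(1) differentiable_imp_continuous_within
  by (metis continuous_at_imp_continuous_on)

text \<open>\<open>pdx f\<close> is known to agree with \<open>a\<close> only on \<open>D\<close>;
  openness of \<open>D\<close> is what transfers the derivative of \<open>a\<close> to
  \<open>pdx f\<close>.\<close>

lemma harmonic_onI:
  assumes D: "open D"
    and f: "\<And>z. z \<in> D \<Longrightarrow> has_partials f (a z) (b z) z"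
    and a: "\<And>z. z \<in> D \<Longrightarrow> has_partials a (a1 z) (a2 z) z"
    and b: "\<And>z. z \<in> D \<Longrightarrow> has_partials b (b1 z) (b2 z) z"
    and c: "continuous_on D a1" "continuous_on D a2" "continuous_on D b1" "continuous_on D b2"
    and L: "\<And>z. z \<in> D \<Longrightarrow> a1 z + b2 z = 0"
  shows "harmonic_on D f"
proof -
  have 1: "C1_on D f"
    using C1_onI[OF f] has_partials_continuous_on[OF a] has_partials_continuous_on[OF b] by blast
  have px: "has_partials (pdx f) (a1 z) (a2 z) z" if "z \<in> D" for z
    using has_partials_cong[OF a[OF that] D that] has_partials_eq(2)[OF f] by metis
  have py: "has_partials (pdy f) (b1 z) (b2 z) z" if "z \<in> D" for z
    using has_partials_cong[OF b[OF that] D that] has_partials_eq(3)[OF f] by metis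
  have "C1_on D (pdx f)" "C1_on D (pdy f)"
    using C1_onI[OF px] C1_onI[OF py] c by blast+
  moreover have "pdx (pdx f) z + pdy (pdy f) z = 0" if "z \<in> D" for z
    using has_partials_eq(2)[OF px[OF that]] has_partials_eq(3)[OF py[OF that]] L[OF that] by simp
  ultimately show ?thesis
    using 1 by (simp add: harmonic_on_def C2_on_def)
qed

lemma harmonic_onD:
  assumes "harmonic_on D f"
  shows "\<And>z. z \<in> D \<Longrightarrow> has_partials f (pdx f z) (pdy f z) z"
    and "\<And>z. z \<in> D \<Longrightarrow> has_partials (pdx f) (pdx (pdx f) z) (pdy (pdx f) z) z"
    and "\<And>z. z \<in> D \<Longrightarrow> has_partials (pdy f) (pdx (pdy f) z) (pdy (pdy f) z) z"
    and "continuous_on D (pdx (pdx f))" "continuous_on D (pdy (pdx f))"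
    and "continuous_on D (pdx (pdy f))" "continuous_on D (pdy (pdy f))"
    and "\<And>z. z \<in> D \<Longrightarrow> pdx (pdx f) z + pdy (pdy f) z = 0"
  using assms by (auto simp: harmonic_on_def C2_on_def C1_on_def intro: differentiable_has_partials)

lemma harmonic_on_continuous_on: "harmonic_on D f \<Longrightarrow> continuous_on D f"
  using harmonic_onD(1) has_partials_continuous_on by metis

lemma harmonic_on_subset: "harmonic_on D f \<Longrightarrow> E \<subseteq> D \<Longrightarrow> harmonic_on E f"
  unfolding harmonic_on_def C2_on_def C1_on_def by (meson continuous_on_subset subsetD)

lemma harmonic_on_cong:
  assumes D: "open D" and fg: "\<And>z. z \<in> D \<Longrightarrow> f z = g z" and f: "harmonic_on D f"
  shows "harmonic_on D g"
proof -
  note h = harmonic_onD[OF f]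
  show ?thesis
    by (rule harmonic_onI[OF D has_partials_cong[OF h(1) D _ fg] h(2,3)]) (use h(4-8) in auto)
qed

lemma harmonic_on_bounded_linear:
  assumes "open D" "bounded_linear L" "harmonic_on D f"
  shows "harmonic_on D (\<lambda>z. L (f z))"
proof -
  interpret bounded_linear L by fact
  note h = harmonic_onD[OF assms(3)]
  note hp = has_partials_bounded_linear[OF assms(2)]
  show ?thesis
    by (rule harmonic_onI[OF assms(1) hp[OF h(1)] hp[OF h(2)] hp[OF h(3)]])
       (auto intro!: continuous_on h(4-7) simp: add[symmetric] h(8) zero)
qed

lemma harmonic_on_add:
  assumes "open D" "harmonic_on D f" "harmonic_on D g"
  shows "harmonic_on D (\<lambda>z. f z + g z)"
proof -
  note f = harmonic_onD[OF assms(2)]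
  note g = harmonic_onD[OF assms(3)]
  note hp = has_partials_add
  show ?thesis
  proof (rule harmonic_onI[OF assms(1) hp[OF f(1) g(1)] hp[OF f(2) g(2)] hp[OF f(3) g(3)]])
    fix z assume "z \<in> D"
    with f(8) g(8) have "(pdx (pdx f) z + pdy (pdy f) z) + (pdx (pdx g) z + pdy (pdy g) z) = 0"
      by simp
    then show "pdx (pdx f) z + pdx (pdx g) z + (pdy (pdy f) z + pdy (pdy g) z) = 0"
      by (simp add: algebra_simps)
  qed (auto intro!: continuous_intros f(4-7) g(4-7))
qed

lemma harmonic_on_const: "open D \<Longrightarrow> harmonic_on D (\<lambda>z. c)"
  by (rule harmonic_onI[where a = "\<lambda>_. 0" and b = "\<lambda>_. 0" and ?a1.0 = "\<lambda>_. 0" and ?a2.0 = "\<lambda>_. 0"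
        and ?b1.0 = "\<lambda>_. 0" and ?b2.0 = "\<lambda>_. 0"]) (auto intro: has_partials_const)

lemma harmonic_on_cmult:
  fixes f :: "complex \<Rightarrow> real"
  shows "open D \<Longrightarrow> harmonic_on D f \<Longrightarrow> harmonic_on D (\<lambda>z. c * f z)"
  using harmonic_on_bounded_linear[OF _ bounded_linear_mult_right] by blast

lemma harmonic_on_inner:
  "open D \<Longrightarrow> harmonic_on D f \<Longrightarrow> harmonic_on D (\<lambda>z. k \<bullet> f z)"
  using harmonic_on_bounded_linear[OF _ bounded_linear_inner_right] by blast

lemma harmonic_on_diff:
  fixes f g :: "complex \<Rightarrow> real"
  assumes "open D" "harmonic_on D f" "harmonic_on D g"
  shows "harmonic_on D (\<lambda>z. f z - g z)"
  using harmonic_on_add[OF assms(1,2) harmonic_on_cmult[OF assms(1,3), of "-1"]] by simp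

text \<open>Here \<open>F\<close> is g_x - i g_y, and its Cauchy-Riemann equations are the Laplace
  equation of \<open>g\<close> together with the symmetry of the mixed partials. Only this
  derivative must be holomorphic, so logarithms of moduli, which lack a single-valued holomorphic
  completion, are covered.\<close>

lemma harmonic_on_partials_Re_Im:
  fixes g :: "complex \<Rightarrow> real"
  assumes D: "open D"
    and g: "\<And>z. z \<in> D \<Longrightarrow> has_partials g (Re (F z)) (- Im (F z)) z"
    and F: "\<And>z. z \<in> D \<Longrightarrow> (F has_field_derivative F' z) (at z)"
    and F': "continuous_on D F'"
  shows "harmonic_on D g"
proof (rule harmonic_onI[OF D g])
  fix z assume z: "z \<in> D"
  show "has_partials (\<lambda>z. Re (F z)) (Re (F' z)) (- Im (F' z)) z"
    by (rule has_partials_Re_holomorphic[OF F[OF z]])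
  have "((\<lambda>z. \<i> * F z) has_field_derivative \<i> * F' z) (at z)"
    by (rule DERIV_cmult[OF F[OF z]])
  from has_partials_Re_holomorphic[OF this]
  show "has_partials (\<lambda>z. - Im (F z)) (- Im (F' z)) (- Re (F' z)) z" by simp
qed (auto intro!: continuous_intros F')

lemma harmonic_on_Re_holomorphic:
  assumes "open D" "\<And>z. z \<in> D \<Longrightarrow> (F has_field_derivative F' z) (at z)"
    "\<And>z. z \<in> D \<Longrightarrow> (F' has_field_derivative F'' z) (at z)" "continuous_on D F''"
  shows "harmonic_on D (\<lambda>z. Re (F z))"
proof (rule harmonic_on_partials_Re_Im[where F = F' and F' = F'', OF assms(1)])
  fix z assume z: "z \<in> D"
  show "has_partials (\<lambda>z. Re (F z)) (Re (F' z)) (- Im (F' z)) z"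
    by (rule has_partials_Re_holomorphic[OF assms(2)[OF z]])
qed (use assms in auto)

lemma harmonic_on_quadratic:
  assumes "open D" shows "harmonic_on D (\<lambda>z. Re (a + b * (z - c) + d * (z - c)^2))"
proof (rule harmonic_on_Re_holomorphic[OF assms])
  show "((\<lambda>z. a + b * (z - c) + d * (z - c)^2) has_field_derivative b + 2 * d * (z - c)) (at z)" for z
    by (auto intro!: derivative_eq_intros)
  show "((\<lambda>z. b + 2 * d * (z - c)) has_field_derivative 2 * d) (at z)" for z
    by (auto intro!: derivative_eq_intros)
qed auto

lemma has_partials_ln_norm:
  assumes "(F has_field_derivative F') (at z)" "F z \<noteq> 0"
  shows "has_partials (\<lambda>w. ln (cmod (F w))) (Re (F' / F z)) (- Im (F' / F z)) z"
proof -
  have F: "(F has_derivative (\<lambda>w. F' * w)) (at z)"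
    using assms by (simp add: has_field_derivative_def)
  have 1: "((\<lambda>w. ln (F w \<bullet> F w) / 2) has_derivative (\<lambda>w. (F z \<bullet> (F' * w)) / (F z \<bullet> F z))) (at z)"
    using assms(2) by (auto intro!: derivative_eq_intros F simp: inner_commute divide_simps)
  \<comment> \<open>At zeros of \<open>F\<close> both sides are 0, the default value of
    \<open>ln 0\<close>.\<close>
  have 2: "(\<lambda>w. ln (F w \<bullet> F w) / 2) = (\<lambda>w. ln (cmod (F w)))"
  proof
    fix w show "ln (F w \<bullet> F w) / 2 = ln (cmod (F w))"
      by (cases "F w = 0") (simp_all add: dot_square_norm ln_realpow)
  qed
  have 3: "(F z \<bullet> (F' * w)) / (F z \<bullet> F z) = Re w * Re (F' / F z) + Im w * - Im (F' / F z)" for w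
    using assms(2)
    by (simp add: inner_complex_def Re_divide Im_divide power2_eq_square add_divide_distrib[symmetric]
      diff_divide_distrib[symmetric] complex_eq_iff) (simp add: algebra_simps)
  show ?thesis
    using 1 unfolding 2 3 by (simp add: has_partials_def)
qed

lemma harmonic_on_ln_norm:
  assumes "open D" "\<And>z. z \<in> D \<Longrightarrow> F z \<noteq> 0" "\<And>z. z \<in> D \<Longrightarrow> (F has_field_derivative F' z) (at z)"
    "\<And>z. z \<in> D \<Longrightarrow> (F' has_field_derivative F'' z) (at z)" "continuous_on D F''"
  shows "harmonic_on D (\<lambda>z. ln (cmod (F z)))"
proof (rule harmonic_on_partials_Re_Im[where F = "\<lambda>z. F' z / F z"
      and F' = "\<lambda>z. (F'' z * F z - F' z * F' z) / (F z * F z)", OF assms(1)])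
  fix z assume z: "z \<in> D"
  show "has_partials (\<lambda>z. ln (cmod (F z))) (Re (F' z / F z)) (- Im (F' z / F z)) z"
    by (rule has_partials_ln_norm[OF assms(3)[OF z] assms(2)[OF z]])
  show "((\<lambda>z. F' z / F z) has_field_derivative (F'' z * F z - F' z * F' z) / (F z * F z)) (at z)"
    by (rule DERIV_divide[OF assms(4)[OF z] assms(3)[OF z] assms(2)[OF z]])
next
  have "continuous_on D F" "continuous_on D F'"
    using assms(3,4) by (auto intro!: continuous_at_imp_continuous_on DERIV_isCont)
  then show "continuous_on D (\<lambda>z. (F'' z * F z - F' z * F' z) / (F z * F z))"
    using assms(2,5) by (auto intro!: continuous_intros)
qed

text \<open>Produces competitors for a smaller target: confining the image costs the factor
  \<open>s\<close> in the derivative at 0.\<close>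

lemma CH_scale:
  fixes f :: "complex \<Rightarrow> 'a::euclidean_space"
  assumes f: "f \<in> CH (ball 0 1) \<Omega>" and s: "0 < s" "s \<le> 1" and im: "f ` ball 0 s \<subseteq> \<Omega>'"
  shows "(\<lambda>z. f (s *\<^sub>R z)) \<in> CH (ball 0 1) \<Omega>'" "pdx (\<lambda>z. f (s *\<^sub>R z)) 0 = s *\<^sub>R pdx f 0"
proof -
  let ?D = "ball (0::complex) 1"
  let ?g = "\<lambda>z. f (s *\<^sub>R z)"
  have sD: "s *\<^sub>R z \<in> ?D \<and> s *\<^sub>R z \<in> ball 0 s" if "z \<in> ?D" for z
  proof -
    have "s * cmod z < s * 1" using that s by (intro mult_strict_left_mono) auto
    then have "s * cmod z < s" "s * cmod z < 1" using s by linarith+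
    then show ?thesis using s by (auto simp: dist_norm)
  qed
  have hf: "harmonic_on ?D f" and cf: "conformal_on ?D f"
    using f by (auto simp: CH_def)
  note h = harmonic_onD[OF hf]
  have p: "has_partials ?g (s *\<^sub>R pdx f (s *\<^sub>R z)) (s *\<^sub>R pdy f (s *\<^sub>R z)) z" if "z \<in> ?D" for z
    using h(1) has_partials_scale sD that by blast
  have p2: "has_partials (\<lambda>w. s *\<^sub>R g (s *\<^sub>R w)) (s *\<^sub>R s *\<^sub>R a) (s *\<^sub>R s *\<^sub>R b) z"
    if "has_partials g a b (s *\<^sub>R z)" for g :: "complex \<Rightarrow> 'a" and a b z
    using has_partials_bounded_linear[OF bounded_linear_scaleR_right has_partials_scale[OF that], of s] .
  have cont: "continuous_on ?D (\<lambda>z. s *\<^sub>R s *\<^sub>R g (s *\<^sub>R z))" if "continuous_on ?D g" for g :: "complex \<Rightarrow> 'a"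
    by (intro continuous_intros continuous_on_compose2[OF that]) (use sD in auto)
  have H: "harmonic_on ?D ?g"
  proof (rule harmonic_onI[OF open_ball p p2[OF h(2)] p2[OF h(3)]])
    fix z assume "z \<in> ?D"
    then have "pdx (pdx f) (s *\<^sub>R z) + pdy (pdy f) (s *\<^sub>R z) = 0" using h(8) sD by blast
    then show "s *\<^sub>R s *\<^sub>R pdx (pdx f) (s *\<^sub>R z) + s *\<^sub>R s *\<^sub>R pdy (pdy f) (s *\<^sub>R z) = 0"
      by (metis scaleR_right_distrib scaleR_zero_right)
  qed (use sD in \<open>blast intro!: cont h(4-7)\<close>)+
  have "C1_on ?D ?g" using H by (simp add: harmonic_on_def C2_on_def)
  moreover have "norm (pdx ?g z) = norm (pdy ?g z) \<and> pdx ?g z \<bullet> pdy ?g z = 0" if "z \<in> ?D" for z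
    using has_partials_eq[OF p[OF that]] cf sD[OF that] by (simp add: conformal_on_def)
  moreover have "?g ` ?D \<subseteq> \<Omega>'" using sD im by auto
  ultimately show "?g \<in> CH ?D \<Omega>'" using H by (simp add: CH_def conformal_on_def)
  show "pdx ?g 0 = s *\<^sub>R pdx f 0"
    using has_partials_eq(2)[OF p[of 0]] by simp
qed

section \<open>Second derivative test and weak maximum principle on discs\<close>

lemma second_derivative_local_max:
  fixes g g' :: "real \<Rightarrow> real"
  assumes "d > 0" and g: "\<And>t. \<bar>t\<bar> < d \<Longrightarrow> (g has_field_derivative g' t) (at t)"
    and g': "(g' has_field_derivative l) (at 0)"
    and max: "\<And>t. \<bar>t\<bar> < d \<Longrightarrow> g t \<le> g 0"
  shows "l \<le> 0"
proof (rule ccontr)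
  assume "\<not> l \<le> 0"
  then obtain e where e: "e > 0" "\<And>h. 0 < h \<Longrightarrow> h < e \<Longrightarrow> g' 0 < g' h"
    using DERIV_pos_inc_right[OF g'] by auto
  have "g' 0 = 0"
    by (rule DERIV_local_max[OF g \<open>d > 0\<close>]) (use assms in auto)
  define t where "t = min d e / 2"
  have t: "0 < t" "t < d" "t < e" using e \<open>d > 0\<close> by (auto simp: t_def)
  obtain x where "0 < x" "x < t" "g t - g 0 = (t - 0) * g' x"
    using MVT2[of 0 t g g'] g t by auto
  moreover have "g' x > 0" using e(2)[of x] \<open>g' 0 = 0\<close> calculation t by simp
  ultimately have "g t > g 0" using t by (smt (verit) mult_pos_pos)
  with max[of t] t show False by simp
qed

lemma has_partials_line:
  fixes f :: "complex \<Rightarrow> real"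
  assumes "has_partials f a b (z + of_real t * c)"
  shows "((\<lambda>t. f (z + of_real t * c)) has_field_derivative (Re c * a + Im c * b)) (at t)"
proof -
  have "((\<lambda>t. z + of_real t * c) has_derivative (\<lambda>h. of_real h * c)) (at t)"
    by (intro derivative_eq_intros) auto
  from has_derivative_compose[OF this assms[unfolded has_partials_def]]
  moreover have "(\<lambda>h. Re (of_real h * c) *\<^sub>R a + Im (of_real h * c) *\<^sub>R b) = (*) (Re c * a + Im c * b)"
    by (auto simp: algebra_simps)
  ultimately show ?thesis by (simp add: has_field_derivative_def)
qed

text \<open>A small multiple of |z - a|^2 makes the Laplacian positive without moving the maximum to
  the boundary; at an interior maximum the second derivatives in the two coordinate directions
  cannot have a positive sum.\<close>

lemma harmonic_on_le_boundary:
  fixes h :: "complex \<Rightarrow> real"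
  assumes "r > 0" and harm: "harmonic_on (ball a r) h" and cont: "continuous_on (cball a r) h"
    and M: "\<And>z. z \<in> sphere a r \<Longrightarrow> h z \<le> M"
  shows "h a \<le> M"
proof (rule ccontr)
  assume "\<not> h a \<le> M"
  \<comment> \<open>Half of the gap \<open>h a - M\<close> is spent at radius \<open>r\<close>, so
    \<open>q\<close> stays below \<open>q a\<close> on the sphere.\<close>
  define e where "e = (h a - M) / (2 * r^2)"
  have e: "e > 0" and er: "e * r^2 = (h a - M) / 2"
    using \<open>\<not> h a \<le> M\<close> \<open>r > 0\<close> by (auto simp: e_def)
  define q where "q = (\<lambda>z. h z + e * (cmod (z - a))^2)"
  have "continuous_on (cball a r) q"
    unfolding q_def by (intro continuous_intros cont)
  then obtain z0 where z0: "z0 \<in> cball a r" "\<And>z. z \<in> cball a r \<Longrightarrow> q z \<le> q z0"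
    using continuous_attains_sup[of "cball a r" q] \<open>r > 0\<close> by auto
  have "z0 \<in> ball a r"
  proof (rule ccontr)
    assume "z0 \<notin> ball a r"
    then have "z0 \<in> sphere a r" using z0 by auto
    then have "q z0 \<le> M + e * r^2" using M by (auto simp: q_def dist_norm norm_minus_commute)
    moreover have "q a \<le> q z0" using z0 \<open>r > 0\<close> by simp
    ultimately have "h a \<le> M + e * r^2" by (simp add: q_def)
    then show False using er \<open>\<not> h a \<le> M\<close> by argo
  qed
  then obtain d where d: "d > 0" "ball z0 d \<subseteq> ball a r"
    using openE open_ball by metis
  note H = harmonic_onD[OF harm]
  \<comment> \<open>Second derivative test on the line through \<open>z0\<close> in direction
    \<open>c\<close>, used for \<open>c = 1\<close> and \<open>c = \<i>\<close>; each direction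
    contributes \<open>2 * e\<close>.\<close>
  have *: "Re c * l1 + Im c * l2 + 2 * e \<le> 0"
    if c: "cmod c = 1" and P: "\<And>z. z \<in> ball a r \<Longrightarrow> p z = Re c * pdx h z + Im c * pdy h z"
      and p: "has_partials p l1 l2 z0" for c p l1 l2
  proof (rule second_derivative_local_max[OF d(1)])
    let ?z = "\<lambda>t. z0 + of_real t * c"
    have in_ball: "?z t \<in> ball a r" if "\<bar>t\<bar> < d" for t
    proof -
      have "?z t \<in> ball z0 d" using that c by (simp add: dist_norm norm_mult)
      then show ?thesis using d by blast
    qed
    have sq: "((\<lambda>t. e * (cmod (?z t - a))^2) has_field_derivative 2 * e * ((?z t - a) \<bullet> c)) (at t)" for t
    proof -
      have "((\<lambda>t. e * ((?z t - a) \<bullet> (?z t - a))) has_derivative (\<lambda>h. e * (2 * ((?z t - a) \<bullet> (of_real h * c))))) (at t)"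
        by (auto intro!: derivative_eq_intros simp: inner_commute)
      moreover have "(\<lambda>h. e * (2 * ((?z t - a) \<bullet> (of_real h * c)))) = (*) (2 * e * ((?z t - a) \<bullet> c))"
        by (auto simp flip: scaleR_conv_of_real)
      ultimately show ?thesis
        by (simp add: has_field_derivative_def power2_norm_eq_inner)
    qed
    show "((\<lambda>t. q (?z t)) has_field_derivative (p (?z t) + 2 * e * ((?z t - a) \<bullet> c))) (at t)"
      if "\<bar>t\<bar> < d" for t
      unfolding q_def P[OF in_ball[OF that]]
      by (intro DERIV_add sq has_partials_line H(1) in_ball that)
    have "((\<lambda>t. 2 * e * ((?z t - a) \<bullet> c)) has_field_derivative 2 * e) (at 0)"
    proof -
      have "((\<lambda>t. 2 * e * ((?z t - a) \<bullet> c)) has_derivative (\<lambda>h. 2 * e * ((of_real h * c) \<bullet> c))) (at 0)"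
        by (auto intro!: derivative_eq_intros)
      moreover have "(of_real h * c) \<bullet> c = h" for h :: real
        using c by (simp flip: scaleR_conv_of_real add: dot_square_norm)
      ultimately show ?thesis by (simp add: has_field_derivative_def)
    qed
    then show "((\<lambda>t. p (?z t) + 2 * e * ((?z t - a) \<bullet> c)) has_field_derivative (Re c * l1 + Im c * l2 + 2 * e)) (at 0)"
      by (intro DERIV_add has_partials_line) (use p in simp_all)
    show "q (?z t) \<le> q (?z 0)" if "\<bar>t\<bar> < d" for t
      using z0(2)[of "?z t"] in_ball[OF that] by simp
  qed
  have z0b: "z0 \<in> ball a r" by fact
  have "pdx (pdx h) z0 + 2 * e \<le> 0"
    using *[of 1 "pdx h", OF _ _ H(2)[OF z0b]] by simp
  moreover have "pdy (pdy h) z0 + 2 * e \<le> 0"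
    using *[of \<i> "pdy h", OF _ _ H(3)[OF z0b]] by simp
  ultimately show False using H(8)[OF z0b] e by linarith
qed

section \<open>Harmonic lower supports\<close>

text \<open>A viscosity-type substitute for "the Laplacian of \<open>H\<close> at \<open>z\<close>
  is at least \<open>4 * c\<close>", meaningful for nonsmooth \<open>H\<close> and for negative
  \<open>c\<close>: a function with that Laplacian at \<open>z\<close> touches \<open>H\<close> from
  below.\<close>

definition lower_support :: "real \<Rightarrow> (complex \<Rightarrow> real) \<Rightarrow> complex \<Rightarrow> bool" where
  "lower_support c H z \<longleftrightarrow> (\<exists>g r. r > 0 \<and> harmonic_on (ball z r) g \<and> g z = H z \<and>
     (\<forall>w\<in>ball z r. g w + c * (cmod (w - z))^2 \<le> H w))"

lemma lower_supportI:
  assumes "open S" "z \<in> S" "harmonic_on S g" "g z = H z"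
    "\<forall>\<^sub>F w in nhds z. g w + c * (cmod (w - z))^2 \<le> H w"
  shows "lower_support c H z"
proof -
  obtain r1 where r1: "r1 > 0" "ball z r1 \<subseteq> S" using assms(1,2) openE by blast
  obtain r2 where r2: "r2 > 0" "\<forall>w. dist w z < r2 \<longrightarrow> g w + c * (cmod (w - z))^2 \<le> H w"
    using assms(5) by (auto simp: eventually_nhds_metric)
  have "harmonic_on (ball z (min r1 r2)) g"
    using r1 by (intro harmonic_on_subset[OF assms(3)]) auto
  then show ?thesis unfolding lower_support_def
    using r1 r2 assms(4) by (intro exI[of _ g] exI[of _ "min r1 r2"]) (auto simp: dist_commute)
qed

lemma lower_supportE:
  assumes "lower_support c H z"
  obtains g r where "r > 0" "harmonic_on (ball z r) g" "g z = H z"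
    "\<forall>\<^sub>F w in nhds z. g w + c * (cmod (w - z))^2 \<le> H w"
proof -
  obtain g r where "r > 0" "harmonic_on (ball z r) g" "g z = H z"
     "\<forall>w\<in>ball z r. g w + c * (cmod (w - z))^2 \<le> H w"
    using assms by (auto simp: lower_support_def)
  with that show ?thesis
    by (metis (mono_tags, lifting) centre_in_ball eventually_nhds open_ball)
qed

lemma lower_support_add:
  assumes "lower_support c H z" "lower_support c' H' z"
  shows "lower_support (c + c') (\<lambda>w. H w + H' w) z"
proof -
  obtain g r where g: "r > 0" "harmonic_on (ball z r) g" "g z = H z"
    "\<forall>\<^sub>F w in nhds z. g w + c * (cmod (w - z))^2 \<le> H w"
    using lower_supportE[OF assms(1)] .
  obtain g' r' where g': "r' > 0" "harmonic_on (ball z r') g'" "g' z = H' z"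
    "\<forall>\<^sub>F w in nhds z. g' w + c' * (cmod (w - z))^2 \<le> H' w"
    using lower_supportE[OF assms(2)] .
  show ?thesis
  proof (rule lower_supportI[of "ball z (min r r')"])
    show "harmonic_on (ball z (min r r')) (\<lambda>w. g w + g' w)"
      by (intro harmonic_on_add open_ball harmonic_on_subset[OF g(2)] harmonic_on_subset[OF g'(2)]) auto
    show "\<forall>\<^sub>F w in nhds z. g w + g' w + (c + c') * (cmod (w - z))\<^sup>2 \<le> H w + H' w"
      using g(4) g'(4) by eventually_elim (simp add: algebra_simps)
  qed (use g g' in auto)
qed

lemma lower_support_mult:
  assumes "lower_support c H z" "b \<ge> 0"
  shows "lower_support (b * c) (\<lambda>w. b * H w) z"
proof -
  obtain g r where g: "r > 0" "harmonic_on (ball z r) g" "g z = H z"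
    "\<forall>\<^sub>F w in nhds z. g w + c * (cmod (w - z))^2 \<le> H w"
    using lower_supportE[OF assms(1)] .
  show ?thesis
  proof (rule lower_supportI[of "ball z r"])
    show "harmonic_on (ball z r) (\<lambda>w. b * g w)"
      by (intro harmonic_on_cmult open_ball g)
    show "\<forall>\<^sub>F w in nhds z. b * g w + b * c * (cmod (w - z))\<^sup>2 \<le> b * H w"
      using g(4)
    proof eventually_elim
      case (elim w)
      then show ?case using mult_left_mono[OF elim assms(2)] by (simp add: algebra_simps)
    qed
  qed (use g in auto)
qed

lemma lower_support_harmonic:
  "open S \<Longrightarrow> z \<in> S \<Longrightarrow> harmonic_on S h \<Longrightarrow> lower_support 0 h z"
  by (rule lower_supportI[of S]) auto

text \<open>A function touching \<open>H\<close> from below also touches any larger function with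
  the same value at \<open>z\<close>. This deals with the seams of piecewise definitions.\<close>

lemma lower_support_mono:
  assumes "lower_support c H z" "c' \<le> c" "\<forall>\<^sub>F w in nhds z. H w \<le> H' w" "H' z = H z"
  shows "lower_support c' H' z"
proof -
  obtain g r where g: "r > 0" "harmonic_on (ball z r) g" "g z = H z"
    "\<forall>\<^sub>F w in nhds z. g w + c * (cmod (w - z))^2 \<le> H w"
    using lower_supportE[OF assms(1)] .
  show ?thesis
  proof (rule lower_supportI[of "ball z r" _ g])
    show "\<forall>\<^sub>F w in nhds z. g w + c' * (cmod (w - z))\<^sup>2 \<le> H' w"
      using g(4) assms(3)
    proof eventually_elim
      case (elim w)
      have "c' * (cmod (w - z))\<^sup>2 \<le> c * (cmod (w - z))\<^sup>2" using assms(2) by (intro mult_right_mono) auto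
      then show ?case using elim by linarith
    qed
  qed (use g assms in auto)
qed

lemma lower_support_cmod_power2: "lower_support 1 (\<lambda>w. (cmod w)^2) z"
proof (rule lower_supportI[of UNIV])
  \<comment> \<open>The affine part of the expansion of |w|^2 about \<open>z\<close>; the remainder
    is exactly |w - z|^2.\<close>
  show "harmonic_on UNIV (\<lambda>w. Re (of_real ((cmod z)^2) + 2 * cnj z * (w - z) + 0 * (w - z)^2))"
    by (rule harmonic_on_quadratic) auto
qed (auto simp: cmod_power2, auto simp: power2_eq_square algebra_simps)

text \<open>At a local maximum the touching harmonic function would lie below its central value by
  \<open>c * s^2\<close> on a small circle of radius \<open>s\<close>, against the maximum
  principle.\<close>

lemma lower_support_no_local_max:
  assumes "lower_support c H z" "c > 0" "\<forall>\<^sub>F w in nhds z. H w \<le> H z"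
  shows False
proof -
  obtain g r where g: "r > 0" "harmonic_on (ball z r) g" "g z = H z"
    "\<forall>\<^sub>F w in nhds z. g w + c * (cmod (w - z))^2 \<le> H w"
    using lower_supportE[OF assms(1)] .
  have "\<forall>\<^sub>F w in nhds z. g w + c * (cmod (w - z))^2 \<le> g z"
    using g(4) assms(3) by eventually_elim (simp add: g(3))
  then obtain d where d: "d > 0" "\<And>w. dist w z < d \<Longrightarrow> g w + c * (cmod (w - z))^2 \<le> g z"
    by (auto simp: eventually_nhds_metric)
  define s where "s = min d r / 2"
  have s: "s > 0" "s < d" "s < r" using d g by (auto simp: s_def)
  have sub: "cball z s \<subseteq> ball z r" "ball z s \<subseteq> ball z r" using s by auto
  have "g z \<le> g z - c * s^2"
  proof (rule harmonic_on_le_boundary[OF s(1) harmonic_on_subset[OF g(2) sub(2)]])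
    show "continuous_on (cball z s) g"
      using continuous_on_subset[OF harmonic_on_continuous_on[OF g(2)] sub(1)] .
    show "g w \<le> g z - c * s^2" if "w \<in> sphere z s" for w
      using d(2)[of w] that s by (auto simp: dist_norm norm_minus_commute)
  qed
  then show False using mult_pos_pos[OF assms(2) zero_less_power[OF s(1), of 2]] by simp
qed

section \<open>Second-order expansions\<close>

lemma norm_power2_diff_le:
  fixes G T :: "'b::real_normed_vector"
  assumes "norm (G - T) \<le> e * N" "norm T \<le> A * N" "0 \<le> e" "0 \<le> N"
  shows "\<bar>(norm G)^2 - (norm T)^2\<bar> \<le> e * (e + 2 * A) * N^2"
proof -
  have 1: "\<bar>norm G - norm T\<bar> \<le> e * N"
    using norm_triangle_ineq3[of G T] assms(1) by linarith
  have 2: "norm G + norm T \<le> (e + 2 * A) * N"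
    using 1 assms(2) by (simp add: algebra_simps)
  have "\<bar>(norm G)^2 - (norm T)^2\<bar> = \<bar>norm G - norm T\<bar> * (norm G + norm T)"
    by (simp add: power2_eq_square square_diff_square_factored abs_mult mult.commute)
  also have "\<dots> \<le> (e * N) * ((e + 2 * A) * N)"
    using 1 2 assms by (intro mult_mono) auto
  finally show ?thesis by (simp add: power2_eq_square mult_ac)
qed

lemma has_partials_remainder:
  assumes "has_partials f a b z" "e > 0"
  shows "\<forall>\<^sub>F w in nhds z. norm (f w - f z - (Re (w - z) *\<^sub>R a + Im (w - z) *\<^sub>R b)) \<le> e * cmod (w - z)"
  using assms unfolding has_partials_def has_derivative_at_alt eventually_nhds_metric dist_norm by blast

lemma norm_partials_le:
  "norm (Re w *\<^sub>R a + Im w *\<^sub>R b) \<le> (norm a + norm b) * cmod w"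
proof -
  have "norm (Re w *\<^sub>R a + Im w *\<^sub>R b) \<le> \<bar>Re w\<bar> * norm a + \<bar>Im w\<bar> * norm b"
    by (metis norm_scaleR norm_triangle_ineq)
  also have "\<dots> \<le> cmod w * norm a + cmod w * norm b"
    by (intro add_mono mult_right_mono abs_Re_le_cmod abs_Im_le_cmod) auto
  finally show ?thesis by (simp add: algebra_simps)
qed

lemma has_partials_increment_power2:
  assumes f: "has_partials f a b z" and e: "e > 0"
  shows "\<forall>\<^sub>F w in nhds z. \<bar>(norm (f w - f z))^2 - (norm (Re (w - z) *\<^sub>R a + Im (w - z) *\<^sub>R b))^2\<bar>
    \<le> e * (cmod (w - z))^2"
proof -
  define A where "A = norm a + norm b"
  define e1 where "e1 = min 1 (e / (1 + 2 * A))"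
  have A: "A \<ge> 0" by (simp add: A_def)
  then have e1: "e1 > 0" "e1 \<le> 1" using e by (auto simp: e1_def)
  have "e1 * (1 + 2 * A) \<le> e / (1 + 2 * A) * (1 + 2 * A)"
    using A by (intro mult_right_mono) (auto simp: e1_def)
  then have e1': "e1 * (1 + 2 * A) \<le> e" using A by simp
  have "e1 * (e1 + 2 * A) \<le> e1 * (1 + 2 * A)" using e1 by (intro mult_left_mono) auto
  then have e2: "e1 * (e1 + 2 * A) \<le> e" using e1' by linarith
  show ?thesis
    using has_partials_remainder[OF f e1(1)]
  proof eventually_elim
    case (elim w)
    have "\<bar>(norm (f w - f z))^2 - (norm (Re (w - z) *\<^sub>R a + Im (w - z) *\<^sub>R b))^2\<bar>
        \<le> e1 * (e1 + 2 * A) * (cmod (w - z))^2"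
      unfolding A_def
      by (rule norm_power2_diff_le[OF elim norm_partials_le]) (use e1 in auto)
    also have "\<dots> \<le> e * (cmod (w - z))^2" using e2 by (intro mult_right_mono) auto
    finally show ?case .
  qed
qed

lemma norm_conformal_power2:
  fixes a b :: "'b::real_inner"
  assumes "norm a = norm b" "a \<bullet> b = 0"
  shows "(norm (Re w *\<^sub>R a + Im w *\<^sub>R b))^2 = (norm a)^2 * (cmod w)^2"
proof -
  have "a \<bullet> a = b \<bullet> b" using assms(1) by (simp add: norm_eq)
  then show ?thesis
    using assms(2) unfolding cmod_power2 power2_norm_eq_inner
    by (simp add: inner_add_left inner_add_right inner_commute[of b a] algebra_simps power2_eq_square)
qed

lemma power2_norm_diff_expand:
  fixes x y p :: "'a::real_inner"
  shows "(norm (x - p))^2 = (norm (y - p))^2 + 2 * ((y - p) \<bullet> (x - y)) + (norm (x - y))^2"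
  by (simp add: power2_norm_eq_inner inner_diff_left inner_diff_right inner_commute)

text \<open>Bessel's inequality, multiplied through by |a|^2 so that critical points of a conformal
  map, where \<open>a = b = 0\<close>, need no exception.\<close>

lemma bessel_two:
  fixes v a b :: "'a::real_inner"
  assumes "norm a = norm b" "a \<bullet> b = 0"
  shows "(v \<bullet> a)^2 + (v \<bullet> b)^2 \<le> (norm v)^2 * (norm a)^2"
proof -
  define S where "S = (v \<bullet> a)^2 + (v \<bullet> b)^2"
  define P where "P = (v \<bullet> a) *\<^sub>R a + (v \<bullet> b) *\<^sub>R b"
  have "(norm P)^2 = (norm a)^2 * S"
    using norm_conformal_power2[OF assms, of "Complex (v \<bullet> a) (v \<bullet> b)"] by (simp add: P_def S_def cmod_power2)
  moreover have "v \<bullet> P = S" by (simp add: P_def S_def inner_add_right power2_eq_square)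
  ultimately have "S^2 \<le> (norm v)^2 * ((norm a)^2 * S)"
    using Cauchy_Schwarz_ineq[of v P] by (simp add: power2_norm_eq_inner)
  moreover have "S \<ge> 0" by (simp add: S_def)
  ultimately have "S \<le> (norm v)^2 * (norm a)^2"
    by (cases "S = 0") (auto simp: power2_eq_square mult.assoc[symmetric])
  then show ?thesis by (simp add: S_def)
qed

lemma ln_one_plus_ge:
  assumes "e > 0"
  shows "\<forall>\<^sub>F t::real in nhds 0. t - (1 / 2 + e) * t^2 \<le> ln (1 + t)"
proof -
  have "((\<lambda>t::real. (ln (1 + t) - t) / t^2) \<longlongrightarrow> - 1 / 2) (at 0)"
    by real_asymp
  then have "\<forall>\<^sub>F t in at 0. - 1 / 2 - e < (ln (1 + t) - t) / t^2"
    by (rule order_tendstoD) (use assms in simp)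
  moreover have "\<forall>\<^sub>F t::real in at 0. t \<noteq> 0" by (simp add: eventually_at_filter)
  ultimately have "\<forall>\<^sub>F t in at 0. t - (1 / 2 + e) * t^2 \<le> ln (1 + t)"
  proof eventually_elim
    case (elim t)
    then have "(- 1 / 2 - e) * t^2 < ln (1 + t) - t" by (simp add: field_simps)
    then show ?case by (simp add: algebra_simps)
  qed
  then show ?thesis by (simp add: eventually_nhds_conv_at)
qed

section \<open>Functions of the distance along a conformal harmonic map\<close>

context
  fixes D :: "complex set" and f :: "complex \<Rightarrow> 'a::euclidean_space" and z :: complex
  assumes D: "open D" "z \<in> D" and conf: "conformal_on D f" and harm: "harmonic_on D f"
begin

lemma partials_at: "has_partials f (pdx f z) (pdy f z) z"
  "norm (pdx f z) = norm (pdy f z)" "pdx f z \<bullet> pdy f z = 0"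
  using harmonic_onD(1)[OF harm D(2)] conf D by (auto simp: conformal_on_def)

lemma conformal_increment:
  assumes "e > 0"
  shows "\<forall>\<^sub>F w in nhds z. \<bar>(norm (f w - f z))^2 - (norm (pdx f z))^2 * (cmod (w - z))^2\<bar> \<le> e * (cmod (w - z))^2"
  using has_partials_increment_power2[OF partials_at(1) assms]
  unfolding norm_conformal_power2[OF partials_at(2,3)] .

lemma harmonic_on_inner_increment: "harmonic_on D (\<lambda>w. k \<bullet> (f w - f z))"
proof -
  have "harmonic_on D (\<lambda>w. k \<bullet> f w + - (k \<bullet> f z))"
    by (intro harmonic_on_add harmonic_on_inner harmonic_on_const D harm)
  then show ?thesis by (simp add: inner_diff_right)
qed

text \<open>In the expansion about \<open>f z\<close> the term linear in the increment is harmonic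
  because \<open>f\<close> is, and conformality turns the squared increment into a multiple of |w -
  z|^2 up to a smaller error. Since the expansion is two-sided, the negative function can be treated
  in the same way.\<close>

lemma lower_support_dist_power2:
  assumes "e > 0"
  shows "lower_support ((norm (pdx f z))^2 - e) (\<lambda>w. (norm (f w - p))^2) z"
proof (rule lower_supportI[OF D])
  show "harmonic_on D (\<lambda>w. (norm (f z - p))^2 + 2 * ((f z - p) \<bullet> (f w - f z)))"
    by (intro harmonic_on_add harmonic_on_cmult harmonic_on_inner_increment harmonic_on_const D)
  show "\<forall>\<^sub>F w in nhds z. (norm (f z - p))^2 + 2 * ((f z - p) \<bullet> (f w - f z)) +
      ((norm (pdx f z))^2 - e) * (cmod (w - z))^2 \<le> (norm (f w - p))^2"
    using conformal_increment[OF assms]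
  proof eventually_elim
    case (elim w)
    then show ?case using power2_norm_diff_expand[of "f w" p "f z"] by (simp add: algebra_simps)
  qed
qed auto

lemma lower_support_neg_dist_power2:
  assumes "e > 0"
  shows "lower_support (- ((norm (pdx f z))^2) - e) (\<lambda>w. - ((norm (f w - p))^2)) z"
proof (rule lower_supportI[OF D])
  have "harmonic_on D (\<lambda>w. (-1) * ((norm (f z - p))^2 + 2 * ((f z - p) \<bullet> (f w - f z))))"
    by (intro harmonic_on_add harmonic_on_cmult harmonic_on_inner_increment harmonic_on_const D)
  then show "harmonic_on D (\<lambda>w. - ((norm (f z - p))^2 + 2 * ((f z - p) \<bullet> (f w - f z))))" by simp
  show "\<forall>\<^sub>F w in nhds z. - ((norm (f z - p))^2 + 2 * ((f z - p) \<bullet> (f w - f z))) +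
      (- ((norm (pdx f z))^2) - e) * (cmod (w - z))^2 \<le> - ((norm (f w - p))^2)"
    using conformal_increment[OF assms]
  proof eventually_elim
    case (elim w)
    then show ?case using power2_norm_diff_expand[of "f w" p "f z"] by (simp add: algebra_simps)
  qed
qed auto

text \<open>With \<open>t\<close> the relative increment of the squared distance, ln (1 + t) is t -
  t^2 / 2 to second order. The gain \<open>a / n\<close> comes from the squared increment of
  \<open>f\<close>, the loss \<open>S / 4\<close> from the mean of t^2 / 2, and
  \<open>bessel_two\<close> says that the gain covers the loss.\<close>

lemma lower_support_ln_dist_power2:
  assumes e: "e > 0" and ne: "f z \<noteq> p"
  shows "lower_support (- e) (\<lambda>w. ln ((norm (f w - p))^2)) z"
proof -
  define v where "v = f z - p"
  define n where "n = (norm v)^2"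
  have n: "n > 0" using ne by (simp add: n_def v_def)
  define s where "s = (\<lambda>w. 2 * (v \<bullet> (f w - f z)) / n)"
  define t where "t = (\<lambda>w. s w + (norm (f w - f z))^2 / n)"
  define \<alpha> where "\<alpha> = 2 * (v \<bullet> pdx f z) / n"
  define \<beta> where "\<beta> = 2 * (v \<bullet> pdy f z) / n"
  define a where "a = (norm (pdx f z))^2"
  define S where "S = \<alpha>^2 + \<beta>^2"
  have ft: "(norm (f w - p))^2 = n * (1 + t w)" for w
    using power2_norm_diff_expand[of "f w" p "f z"] n by (simp add: t_def s_def n_def v_def field_simps)
  have t0: "t z = 0" by (simp add: t_def s_def)
  have tp: "has_partials t \<alpha> \<beta> z"
  proof -
    have "((\<lambda>w. 2 * (v \<bullet> (f w - f z)) / n + ((f w - f z) \<bullet> (f w - f z)) / n) has_derivative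
      (\<lambda>w. 2 * (v \<bullet> (Re w *\<^sub>R pdx f z + Im w *\<^sub>R pdy f z)) / n)) (at z)"
      using n by (auto intro!: derivative_eq_intros partials_at(1)[unfolded has_partials_def])
    moreover have "(\<lambda>w. 2 * (v \<bullet> (Re w *\<^sub>R pdx f z + Im w *\<^sub>R pdy f z)) / n) = (\<lambda>w. Re w *\<^sub>R \<alpha> + Im w *\<^sub>R \<beta>)"
      by (auto simp: \<alpha>_def \<beta>_def inner_add_right add_divide_distrib algebra_simps)
    ultimately show ?thesis
      by (simp add: has_partials_def t_def s_def power2_norm_eq_inner)
  qed
  have "S = 4 * ((v \<bullet> pdx f z)^2 + (v \<bullet> pdy f z)^2) / n^2"
    by (simp add: S_def \<alpha>_def \<beta>_def power_divide power_mult_distrib add_divide_distrib)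
  also have "\<dots> \<le> 4 * (n * a) / n^2"
    using bessel_two[OF partials_at(2,3), of v] by (intro divide_right_mono) (auto simp: n_def a_def)
  finally have S: "S \<le> 4 * a / n" using n by (simp add: power2_eq_square)
  have S0: "S \<ge> 0" by (simp add: S_def)
  \<comment> \<open>Shares of the error \<open>e\<close>: \<open>e1\<close> is for the squared
    increment of \<open>f\<close>, \<open>e2\<close> for replacing \<open>t\<close> by its linear
    part inside the square, and \<open>e3\<close> for the remainder of the logarithm.\<close>
  define e1 where "e1 = n * e / 3"
  define e2 where "e2 = min 1 (e / 3)"
  define e3 where "e3 = min 1 (e / 3 / (S + 1))"
  have es: "e1 > 0" "e2 > 0" "e2 \<le> 1" "e2 \<le> e / 3" "e3 > 0" "e3 \<le> 1"
    using e n S0 by (auto simp: e1_def e2_def e3_def)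
  have "e3 * (S + 1) \<le> e / 3 / (S + 1) * (S + 1)"
    unfolding e3_def using S0 by (intro mult_right_mono) auto
  also have "\<dots> = e / 3" using S0 by (intro nonzero_eq_divide_eq[THEN iffD1]) auto
  finally have e3: "e3 * (S + 1) \<le> e / 3" .
  \<comment> \<open>The square of the linear part of \<open>t\<close> is split into its
    rotation-invariant part and a harmonic quadratic form \<open>q\<close>. The latter is moved into
    the touching function, so only the invariant part counts as a loss.\<close>
  define A where "A = (\<alpha>^2 - \<beta>^2) / 2"
  define B where "B = \<alpha> * \<beta>"
  define q where "q = (\<lambda>w. Re (0 + 0 * (w - z) + Complex A (- B) * (w - z)^2))"
  have L: "(Re w * \<alpha> + Im w * \<beta>)^2 = S / 2 * (cmod w)^2 + Re (Complex A (- B) * w^2)" for w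
    unfolding S_def A_def B_def cmod_power2
    by (simp add: power2_eq_square field_simps)
  have "isCont t z"
    using has_partials_eq(1)[OF tp] by (rule differentiable_imp_continuous_within)
  then have lim: "filterlim t (nhds 0) (nhds z)"
    using t0 tendsto_at_iff_tendsto_nhds[of t z] by (simp add: isCont_def)
  show ?thesis
  proof (rule lower_supportI[OF D])
    have "harmonic_on D (\<lambda>w. (ln n + (2 / n) * (v \<bullet> (f w - f z))) - (1/2) * q w)"
      unfolding q_def
      by (intro harmonic_on_diff harmonic_on_add harmonic_on_cmult harmonic_on_inner_increment
          harmonic_on_const harmonic_on_quadratic D)
    then show "harmonic_on D (\<lambda>w. ln n + s w - q w / 2)" by (simp add: s_def)
    show "ln n + s z - q z / 2 = ln ((norm (f z - p))^2)"
      by (simp add: s_def q_def n_def v_def)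
    have "\<forall>\<^sub>F w in nhds z. t w - (1 / 2 + e3) * (t w)^2 \<le> ln (1 + t w)"
      using lim ln_one_plus_ge[OF es(5)] by (rule eventually_compose_filterlim[rotated])
    moreover have "\<forall>\<^sub>F w in nhds z. \<bar>t w\<bar> < 1"
      using order_tendstoD(2)[OF tendsto_rabs[OF lim], of 1] by simp
    moreover note conformal_increment[OF es(1)] has_partials_increment_power2[OF tp es(2)]
    ultimately show "\<forall>\<^sub>F w in nhds z. ln n + s w - q w / 2 + - e * (cmod (w - z))^2 \<le> ln ((norm (f w - p))^2)"
    proof eventually_elim
      case (elim w)
      define N where "N = (cmod (w - z))^2"
      have N: "N \<ge> 0" by (simp add: N_def)
      have "(a - e1) * N \<le> (norm (f w - f z))^2"
        using elim(3) by (simp add: a_def N_def algebra_simps)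
      then have "(a - e1) * N / n \<le> (norm (f w - f z))^2 / n"
        using n by (intro divide_right_mono) auto
      moreover have "(a - e1) * N / n = a / n * N - e / 3 * N"
        using n by (simp add: e1_def field_simps)
      ultimately have 1: "s w + a / n * N - e / 3 * N \<le> t w" by (simp add: t_def)
      have "(t w)^2 \<le> (Re (w - z) * \<alpha> + Im (w - z) * \<beta>)^2 + e2 * N"
        using elim(4) t0 by (simp add: N_def)
      then have 2: "(t w)^2 \<le> S / 2 * N + q w + e2 * N"
        unfolding L by (simp add: q_def N_def)
      have "S / 2 * N + q w \<le> S * N"
      proof -
        have "(Re (w - z) * \<alpha> + Im (w - z) * \<beta>)^2 \<le> ((cmod (w-z))^2) * (cmod (Complex \<alpha> \<beta>))^2"
          using Cauchy_Schwarz_ineq[of "w - z" "Complex \<alpha> \<beta>"]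
          by (simp add: inner_complex_def power2_norm_eq_inner)
        then show ?thesis unfolding L by (simp add: q_def N_def S_def cmod_power2 mult.commute)
      qed
      then have "(t w)^2 \<le> (S + e2) * N" using 2 by (simp add: algebra_simps)
      also have "\<dots> \<le> (S + 1) * N" using es N by (intro mult_right_mono) auto
      finally have "e3 * (t w)^2 \<le> e3 * ((S + 1) * N)" using es by (intro mult_left_mono) auto
      also have "\<dots> = (e3 * (S + 1)) * N" by simp
      also have "\<dots> \<le> e / 3 * N" using e3 N by (intro mult_right_mono) auto
      finally have 3: "e3 * (t w)^2 \<le> e / 3 * N" .
      have 4: "e2 * N \<le> e / 3 * N" using es N by (intro mult_right_mono) auto
      have 5: "S / 4 * N \<le> a / n * N" using S N by (intro mult_right_mono) (simp_all add: mult.commute)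
      have "ln ((norm (f w - p))^2) = ln n + ln (1 + t w)"
        unfolding ft using n elim(2) by (simp add: ln_mult_pos)
      moreover have "e * N / 6 \<ge> 0" using e N by simp
      ultimately show ?case
        using elim(1) 1 2 3 4 5 unfolding N_def[symmetric] by (simp add: algebra_simps)
    qed
  qed
qed

end

section \<open>MPSH functions along conformal harmonic maps\<close>

lemma aff_dim_conformal_plane:
  fixes e1 e2 y :: "'a::euclidean_space"
  assumes "norm e1 = norm e2" "e1 \<noteq> 0" "e1 \<bullet> e2 = 0"
  shows "affine (range (\<lambda>z. y + Re z *\<^sub>R e1 + Im z *\<^sub>R e2))"
    and "aff_dim (range (\<lambda>z. y + Re z *\<^sub>R e1 + Im z *\<^sub>R e2)) = 2"
proof -
  have e2: "e2 \<noteq> 0" using assms by auto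
  have ne: "e1 \<noteq> e2" using assms by auto
  have ind: "independent {e1, e2}"
    by (rule pairwise_orthogonal_independent)
       (use assms e2 in \<open>auto simp: pairwise_def orthogonal_def inner_commute\<close>)
  have eq: "range (\<lambda>z. y + Re z *\<^sub>R e1 + Im z *\<^sub>R e2) = (+) y ` span {e1, e2}"
  proof safe
    fix z show "y + Re z *\<^sub>R e1 + Im z *\<^sub>R e2 \<in> (+) y ` span {e1, e2}"
      unfolding add.assoc by (intro imageI span_add span_scale span_base) auto
  next
    fix v assume "v \<in> span {e1, e2}"
    then obtain a b where "v = a *\<^sub>R e1 + b *\<^sub>R e2"
      by (auto simp: span_insert span_singleton) (metis add_diff_cancel_left' add_diff_eq diff_add_cancel)
    then show "y + v \<in> range (\<lambda>z. y + Re z *\<^sub>R e1 + Im z *\<^sub>R e2)"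
      by (intro image_eqI[of _ _ "Complex a b"]) (auto simp: add.assoc)
  qed
  show "affine (range (\<lambda>z. y + Re z *\<^sub>R e1 + Im z *\<^sub>R e2))"
    unfolding eq by (meson affine_translation subspace_imp_affine subspace_span)
  show "aff_dim (range (\<lambda>z. y + Re z *\<^sub>R e1 + Im z *\<^sub>R e2)) = 2"
    unfolding eq aff_dim_translation_eq
    using ind ne by (simp add: aff_dim_subspace dim_eq_card_independent)
qed

text \<open>The plane may degenerate to a point, since conformal maps can have critical points. Then
  the MPSH condition says nothing, and the claim is the minimum principle for
  \<open>h\<close>.\<close>

lemma MPSH_on_harmonic_majorant:
  fixes u :: "'a::euclidean_space \<Rightarrow> real"
  assumes mpsh: "MPSH_on \<Omega> (\<lambda>x. ereal (u x))"
    and e: "norm e1 = norm e2" "e1 \<bullet> e2 = 0" and "r > 0"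
    and sub: "\<And>w. w \<in> cball z r \<Longrightarrow> y + Re (w - z) *\<^sub>R e1 + Im (w - z) *\<^sub>R e2 \<in> \<Omega>"
    and h: "continuous_on (cball z r) h" "harmonic_on (ball z r) h"
    and le: "\<And>w. w \<in> sphere z r \<Longrightarrow> u (y + Re (w - z) *\<^sub>R e1 + Im (w - z) *\<^sub>R e2) \<le> h w"
  shows "u y \<le> h z"
proof (cases "e1 = 0")
  case True
  then have "e2 = 0" using e by auto
  have "- h z \<le> - u y"
  proof (rule harmonic_on_le_boundary[OF \<open>r > 0\<close>])
    show "harmonic_on (ball z r) (\<lambda>w. - h w)"
      using harmonic_on_cmult[OF open_ball h(2), of "-1"] by simp
  qed (use h le True \<open>e2 = 0\<close> in \<open>auto intro!: continuous_intros\<close>)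
  then show ?thesis by simp
next
  case False
  define \<psi> where "\<psi> = (\<lambda>w. (y - Re z *\<^sub>R e1 - Im z *\<^sub>R e2) + Re w *\<^sub>R e1 + Im w *\<^sub>R e2)"
  have \<psi>: "\<psi> w = y + Re (w - z) *\<^sub>R e1 + Im (w - z) *\<^sub>R e2" for w
    by (simp add: \<psi>_def algebra_simps)
  have "affine (range \<psi>)" "aff_dim (range \<psi>) = 2"
    unfolding \<psi>_def using aff_dim_conformal_plane[OF e(1) False e(2)] by blast+
  moreover have "conformal_coordinates (range \<psi>) \<psi>"
    unfolding conformal_coordinates_def \<psi>_def using e False by blast
  ultimately have sh: "subharmonic_on (\<psi> -` (range \<psi> \<inter> \<Omega>)) (\<lambda>w. ereal (u (\<psi> w)))"
    using mpsh unfolding MPSH_on_def by blast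
  have "cball z r \<subseteq> \<psi> -` (range \<psi> \<inter> \<Omega>)" using sub \<psi> by auto
  moreover have "\<forall>w\<in>sphere z r. ereal (u (\<psi> w)) \<le> ereal (h w)" using le \<psi> by auto
  ultimately have "\<forall>w\<in>ball z r. ereal (u (\<psi> w)) \<le> ereal (h w)"
    using sh h \<open>r > 0\<close> unfolding subharmonic_on_def by blast
  then show ?thesis using \<open>r > 0\<close> \<psi>[of z] by auto
qed

text \<open>The zero terms give the middle summand the exact form of
  \<open>harmonic_on_quadratic\<close>.\<close>

lemma power2_norm_shift:
  fixes z :: complex
  shows "(cmod (w - a))^2 = (cmod (z - a))^2 + Re (0 + 2 * cnj (z - a) * (w - z) + 0 * (w - z)^2) + (cmod (w - z))^2"
  by (simp add: cmod_power2) (simp add: power2_eq_square algebra_simps)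

text \<open>The maximum of \<open>u (f z + k) + H z - |k|\<^sup>2 / \<epsilon>\<close> over a point \<open>z\<close> and a translation \<open>k\<close> is perturbed
  by moving \<open>z\<close> to \<open>w\<close> and choosing \<open>k\<close> so that \<open>f w + k\<close> runs through an affine plane; the penalty
  then varies by a harmonic function up to a fourth order error.\<close>

lemma MPSH_conformal_harmonic_no_local_max:
  fixes u :: "'a::euclidean_space \<Rightarrow> real"
  assumes D: "open D" "z0 \<in> D" and conf: "conformal_on D f" and harm: "harmonic_on D f"
    and fD: "f ` D \<subseteq> \<Omega>" and \<Omega>: "open \<Omega>" and u: "continuous_on \<Omega> u"
    and mpsh: "MPSH_on \<Omega> (\<lambda>x. ereal (u x))"
    and H: "continuous_on D H" and c: "c > 0" "\<And>z. z \<in> D \<Longrightarrow> lower_support c H z"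
    and max: "\<And>z. z \<in> D \<Longrightarrow> u (f z) + H z \<le> u (f z0) + H z0"
  shows False
proof -
  obtain r where r: "r > 0" "cball z0 r \<subseteq> D" using D open_contains_cball by blast
  define C where "C = cball z0 r"
  have contf: "continuous_on D f" by (rule harmonic_on_continuous_on[OF harm])
  have "compact (f ` C)"
    using contf r by (intro compact_continuous_image) (auto simp: C_def intro: continuous_on_subset)
  moreover have "f ` C \<subseteq> \<Omega>" using r fD by (auto simp: C_def)
  ultimately obtain r2 where r2: "r2 > 0" "{y + k | y k. y \<in> f ` C \<and> k \<in> cball 0 r2} \<subseteq> \<Omega>"
  proof -
    assume *: "compact (f ` C)" "f ` C \<subseteq> \<Omega>"
      and th: "\<And>r2. r2 > 0 \<Longrightarrow> {y + k | y k. y \<in> f ` C \<and> k \<in> cball 0 r2} \<subseteq> \<Omega> \<Longrightarrow> thesis"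
    obtain e where e: "e > 0" "(\<Union>x\<in>f ` C. cball x e) \<subseteq> \<Omega>"
      using compact_subset_open_imp_cball_epsilon_subset[OF * (1) \<Omega> * (2)] by blast
    have "y + k \<in> cball y e" if "k \<in> cball 0 e" for y k :: 'a
      using that by (simp add: dist_norm)
    with e show thesis by (intro th[of e]) blast+
  qed
  define K where "K = {y + k | y k. y \<in> f ` C \<and> k \<in> cball 0 r2}"
  have K: "compact K" "K \<subseteq> \<Omega>"
    unfolding K_def using compact_sums[OF \<open>compact (f ` C)\<close> compact_cball[of 0 r2]] r2 by (blast, blast)
  have uK: "continuous_on K u" using u K continuous_on_subset by blast
  have inK: "f z + k \<in> K" if "z \<in> C" "norm k \<le> r2" for z k
    using that by (auto simp: K_def)
  obtain M where M: "M > 0" "\<And>y. y \<in> K \<Longrightarrow> norm (u y) \<le> M"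
    using compact_imp_bounded[OF compact_continuous_image[OF uK K(1)]] by (auto simp: bounded_pos)
  have "uniformly_continuous_on K u"
    using compact_uniformly_continuous[OF uK K(1)] .
  moreover have "c / 2 * r^2 > 0" using c r by simp
  ultimately obtain s where s: "s > 0"
    "\<And>x y. x \<in> K \<Longrightarrow> y \<in> K \<Longrightarrow> dist x y < s \<Longrightarrow> dist (u x) (u y) < c / 2 * r^2"
    unfolding uniformly_continuous_on_def by metis
  define \<rho> where "\<rho> = min s r2"
  have \<rho>: "\<rho> > 0" "\<rho> \<le> s" "\<rho> \<le> r2" using s r2 by (auto simp: \<rho>_def)
  \<comment> \<open>Since \<open>u\<close> varies by at most \<open>2 * M\<close> on
    \<open>K\<close>, this penalty forces |k|^2 to be at most half of \<open>\<rho>^2\<close>. Hence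
    \<open>k\<close> lies in the interior of its ball and within the range of uniform continuity of
    \<open>u\<close>.\<close>
  define \<epsilon> where "\<epsilon> = \<rho>^2 / (4 * M)"
  have \<epsilon>: "\<epsilon> > 0" using \<rho> M by (simp add: \<epsilon>_def)
  \<comment> \<open>Half of the strictness \<open>c\<close> is given up to keep the maximizing
    \<open>z\<close> inside the disc around \<open>z0\<close>.\<close>
  define \<Psi> where "\<Psi> = (\<lambda>(z, k). u (f z + k) + H z - c / 2 * (cmod (z - z0))^2 - (norm k)^2 / \<epsilon>)"
  have CD: "C \<subseteq> D" using r by (simp add: C_def)
  have "compact (C \<times> cball (0::'a) r2)" by (simp add: C_def compact_Times)
  moreover have "C \<times> cball (0::'a) r2 \<noteq> {}" using r r2 by (auto simp: C_def)
  moreover have "continuous_on (C \<times> cball (0::'a) r2) \<Psi>"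
    unfolding \<Psi>_def case_prod_unfold
    by (intro continuous_intros continuous_on_compose2[OF uK] continuous_on_compose2[OF contf]
        continuous_on_compose2[OF H]) (use \<epsilon> CD in \<open>auto simp: inK\<close>)
  ultimately obtain zk where zk: "zk \<in> C \<times> cball (0::'a) r2" "\<And>w. w \<in> C \<times> cball 0 r2 \<Longrightarrow> \<Psi> w \<le> \<Psi> zk"
    using continuous_attains_sup by metis
  obtain z k where zk_eq: "zk = (z, k)" by (cases zk)
  have z: "z \<in> C" and k: "norm k \<le> r2"
    and best: "\<And>w l. w \<in> C \<Longrightarrow> norm l \<le> r2 \<Longrightarrow> \<Psi> (w, l) \<le> \<Psi> (z, k)"
    using zk by (auto simp: zk_eq)
  have zD: "z \<in> D" using z r by (auto simp: C_def)
  have pen: "(norm k)^2 / \<epsilon> + c / 2 * (cmod (z - z0))^2 \<le> u (f z + k) - u (f z)"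
    using best[of z0 0] max[OF zD] r r2 by (simp add: \<Psi>_def C_def)
  have fzk: "f z + k \<in> K" "f z \<in> K" using inK[OF z k] inK[OF z, of 0] r2 by auto
  have "(norm k)^2 / \<epsilon> \<le> 2 * M"
    using pen M(2)[OF fzk(1)] M(2)[OF fzk(2)] c by (smt (verit) mult_nonneg_nonneg real_norm_def zero_le_power2 divide_nonneg_pos)
  then have "(norm k)^2 \<le> 2 * M * \<epsilon>" using \<epsilon> by (simp add: field_simps)
  also have "\<dots> < \<rho>^2" using M \<rho> by (simp add: \<epsilon>_def)
  finally have k\<rho>: "norm k < \<rho>" using \<rho> by (simp add: power_less_imp_less_base)
  have "dist (u (f z + k)) (u (f z)) < c / 2 * r^2"
    by (rule s(2)[OF fzk]) (use k\<rho> \<rho> in \<open>simp add: dist_norm\<close>)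
  then have "u (f z + k) - u (f z) < c / 2 * r^2" unfolding dist_real_def by linarith
  moreover have "(norm k)^2 / \<epsilon> \<ge> 0" using \<epsilon> by simp
  ultimately have "c / 2 * (cmod (z - z0))^2 < c / 2 * r^2" using pen by linarith
  then have "(cmod (z - z0))^2 < r^2" using c by simp
  then have "cmod (z - z0) < r" using r by (simp add: power_less_imp_less_base)
  then have zb: "z \<in> ball z0 r" by (simp add: dist_norm norm_minus_commute)

  define fx where "fx = pdx f z"
  define fy where "fy = pdy f z"
  have part: "has_partials f fx fy z" "norm fx = norm fy" "fx \<bullet> fy = 0"
    using partials_at[OF D(1) zD conf harm] by (auto simp: fx_def fy_def)
  define T where "T = (\<lambda>w. Re (w - z) *\<^sub>R fx + Im (w - z) *\<^sub>R fy)"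
  define e where "e = (\<lambda>w. f w - f z - T w)"
  obtain g \<rho>g where g: "\<rho>g > 0" "harmonic_on (ball z \<rho>g) g" "g z = H z"
    "\<forall>\<^sub>F w in nhds z. g w + c * (cmod (w - z))^2 \<le> H w"
    using lower_supportE[OF c(2)[OF zD]] .
  \<comment> \<open>Obtained by solving the maximality of \<open>(z, k)\<close>, tested at
    \<open>w\<close> and \<open>k - e w\<close>, for the value of \<open>u\<close>. All terms kept
    here are harmonic in \<open>w\<close>.\<close>
  define h0 where "h0 = (\<lambda>w. (u (f z + k) + g z) - g w + (c / 2) * Re (0 + 2 * cnj (z - z0) * (w - z) + 0 * (w - z)^2)
    - (2 / \<epsilon>) * (k \<bullet> f w - (k \<bullet> f z + k \<bullet> T w)))"
  have e0: "e z = 0" by (simp add: e_def T_def)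
  have h0z: "h0 z = u (f z + k)" by (simp add: h0_def T_def)
  \<comment> \<open>Makes \<open>(norm (e w))^2 / \<epsilon>\<close> at most \<open>c / 4\<close>
    times |w - z|^2. Of the strictness \<open>c\<close>, one half went to localization and one
    quarter goes here; the last quarter yields the contradiction.\<close>
  define q where "q = sqrt (c * \<epsilon> / 4)"
  have q: "q > 0" "q^2 / \<epsilon> = c / 4" using c \<epsilon> by (auto simp: q_def)
  have "((\<lambda>w. norm (k - e w)) \<longlongrightarrow> norm (k - e z)) (nhds z)"
  proof -
    have "isCont f z" using has_partials_eq(1)[OF part(1)] by (rule differentiable_imp_continuous_within)
    then have "isCont (\<lambda>w. norm (k - e w)) z"
      unfolding e_def T_def by (intro continuous_intros isCont_Re isCont_Im)
    then show ?thesis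
      by (rule tendsto_at_iff_tendsto_nhds[of "\<lambda>w. norm (k - e w)", THEN iffD1, OF isCont_def[THEN iffD1]])
  qed
  then have "\<forall>\<^sub>F w in nhds z. norm (k - e w) < r2"
    by (rule order_tendstoD) (use k\<rho> \<rho> e0 in simp)
  moreover have "\<forall>\<^sub>F w in nhds z. w \<in> ball z0 r \<inter> ball z \<rho>g"
    using zb g(1) by (intro eventually_nhds_in_open) auto
  moreover have "\<forall>\<^sub>F w in nhds z. norm (e w) \<le> q * cmod (w - z)"
    using has_partials_remainder[OF part(1) q(1)] by (simp add: e_def T_def)
  ultimately have "\<forall>\<^sub>F w in nhds z. w \<in> ball z \<rho>g \<and> f z + k + T w \<in> \<Omega> \<and>
      u (f z + k + T w) \<le> h0 w - c / 4 * (cmod (w - z))^2"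
    using g(4)
  proof eventually_elim
    case (elim w)
    have wC: "w \<in> C" using elim by (auto simp: C_def)
    \<comment> \<open>The translation \<open>k - e w\<close> replaces \<open>f w\<close> by its
      linearization, so that \<open>u\<close> is evaluated on the plane through
      \<open>f z + k\<close> spanned by the partials.\<close>
    have eq: "f w + (k - e w) = f z + k + T w" by (simp add: e_def)
    have "f z + k + T w \<in> \<Omega>" using inK[OF wC, of "k - e w"] elim K(2) eq by auto
    moreover have "u (f z + k + T w) \<le> h0 w - c / 4 * (cmod (w - z))^2"
    proof -
      have "(norm (e w))^2 \<le> (q * cmod (w - z))^2" using elim by (intro power_mono) auto
      then have "(norm (e w))^2 / \<epsilon> \<le> q^2 / \<epsilon> * (cmod (w - z))^2"
        using \<epsilon> by (simp add: power_mult_distrib divide_right_mono)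
      then have 1: "(norm (e w))^2 / \<epsilon> \<le> c / 4 * (cmod (w - z))^2" by (simp only: q(2))
      have 2: "(norm (k - e w))^2 / \<epsilon> = (norm k)^2 / \<epsilon> - 2 / \<epsilon> * (k \<bullet> e w) + (norm (e w))^2 / \<epsilon>"
        using \<epsilon> by (simp add: power2_norm_eq_inner inner_diff_left inner_diff_right inner_commute field_simps)
      have 3: "k \<bullet> e w = k \<bullet> f w - (k \<bullet> f z + k \<bullet> T w)"
        by (simp add: e_def inner_diff_right)
      have 4: "c / 2 * (cmod (w - z0))\<^sup>2 = c / 2 * (cmod (z - z0))\<^sup>2
        + (c / 2) * Re (0 + 2 * cnj (z - z0) * (w - z) + 0 * (w - z)^2) + c / 2 * (cmod (w - z))^2"
        unfolding power2_norm_shift[of w z0 z] by (simp only: distrib_left)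
      have "u (f z + k + T w) + H w - c / 2 * (cmod (w - z0))\<^sup>2 - (norm (k - e w))^2 / \<epsilon>
        \<le> u (f z + k) + H z - c / 2 * (cmod (z - z0))\<^sup>2 - (norm k)^2 / \<epsilon>"
        using best[OF wC, of "k - e w"] elim unfolding \<Psi>_def eq[symmetric] by simp
      then show ?thesis
        using 1 elim(4) g(3) unfolding h0_def 2 4 3[symmetric] by argo
    qed
    ultimately show ?case using elim by blast
  qed
  then obtain d where d: "d > 0" "\<And>w. dist w z < d \<Longrightarrow> w \<in> ball z \<rho>g \<and> f z + k + T w \<in> \<Omega> \<and>
      u (f z + k + T w) \<le> h0 w - c / 4 * (cmod (w - z))^2"
    by (auto simp: eventually_nhds_metric)
  obtain t where t: "0 < t" "t < d" "cball z t \<subseteq> D"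
  proof -
    obtain t' where "t' > 0" "cball z t' \<subseteq> D" using D(1) zD open_contains_cball by blast
    moreover have "cball z (min t' (d / 2)) \<subseteq> cball z t'" by auto
    ultimately show thesis using that[of "min t' (d / 2)"] d(1) by fastforce
  qed
  have sub: "cball z t \<subseteq> ball z \<rho>g" using d(2) t by (auto simp: dist_commute)
  have "harmonic_on (D \<inter> ball z \<rho>g) (\<lambda>w. h0 w - c / 4 * t^2)"
  proof -
    have kT: "k \<bullet> T w = Re (0 + Complex (k \<bullet> fx) (- (k \<bullet> fy)) * (w - z) + 0 * (w - z)^2)" for w
      by (simp add: T_def inner_add_right)
    have o: "open (D \<inter> ball z \<rho>g)" using D by auto
    show ?thesis
      unfolding h0_def kT
      by (intro harmonic_on_diff harmonic_on_add harmonic_on_cmult harmonic_on_inner harmonic_on_const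
          harmonic_on_quadratic o harmonic_on_subset[OF harm] harmonic_on_subset[OF g(2)]) auto
  qed
  moreover have "cball z t \<subseteq> D \<inter> ball z \<rho>g" using sub t by auto
  ultimately have h: "harmonic_on (cball z t) (\<lambda>w. h0 w - c / 4 * t^2)" "harmonic_on (ball z t) (\<lambda>w. h0 w - c / 4 * t^2)"
    using ball_subset_cball harmonic_on_subset by metis+
  have "u (f z + k) \<le> h0 z - c / 4 * t^2"
  proof (rule MPSH_on_harmonic_majorant[OF mpsh part(2,3) t(1) _ harmonic_on_continuous_on[OF h(1)] h(2)])
    fix w assume "w \<in> cball z t"
    then show "f z + k + Re (w - z) *\<^sub>R fx + Im (w - z) *\<^sub>R fy \<in> \<Omega>"
      using d(2)[of w] t by (auto simp: T_def dist_commute add.assoc)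
  next
    fix w assume "w \<in> sphere z t"
    then show "u (f z + k + Re (w - z) *\<^sub>R fx + Im (w - z) *\<^sub>R fy) \<le> h0 w - c / 4 * t^2"
      using d(2)[of w] t by (auto simp: T_def dist_commute add.assoc dist_norm norm_minus_commute)
  qed
  then show False using h0z mult_pos_pos[OF c(1) zero_less_power[OF t(1), of 2]] by simp
qed

section \<open>Pseudohyperbolic distance and the pole cutoff\<close>

definition pseudohyp :: "complex \<Rightarrow> complex \<Rightarrow> real" where
  "pseudohyp a z = cmod (z - a) / cmod (1 - cnj a * z)"

lemma one_minus_cnj_mult_neq_0:
  assumes "cmod a < 1" "cmod z \<le> 1"
  shows "1 - cnj a * z \<noteq> 0"
proof
  assume "1 - cnj a * z = 0"
  then have "cmod (cnj a * z) = 1" by (metis norm_one right_minus_eq)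
  moreover have "cmod (cnj a * z) \<le> cmod a * 1"
    unfolding norm_mult complex_mod_cnj using assms by (intro mult_left_mono) auto
  ultimately show False using assms by simp
qed

lemma pseudohyp_0_right [simp]: "pseudohyp a 0 = cmod a"
  and pseudohyp_0_left [simp]: "pseudohyp 0 z = cmod z"
  and pseudohyp_refl [simp]: "pseudohyp a a = 0"
  and pseudohyp_nonneg: "pseudohyp a z \<ge> 0"
  by (auto simp: pseudohyp_def)

lemma pseudohyp_pos: "cmod a < 1 \<Longrightarrow> cmod z \<le> 1 \<Longrightarrow> z \<noteq> a \<Longrightarrow> pseudohyp a z > 0"
  using one_minus_cnj_mult_neq_0 by (auto simp: pseudohyp_def)

lemma continuous_on_pseudohyp: "cmod a < 1 \<Longrightarrow> continuous_on (cball 0 1) (pseudohyp a)"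
  unfolding pseudohyp_def using one_minus_cnj_mult_neq_0
  by (intro continuous_intros) auto

text \<open>The factor \<open>1 - (cmod z)^2\<close> yields both the value 1 on the unit circle and
  the strict bound inside.\<close>

lemma one_minus_pseudohyp_power2:
  assumes "cmod a < 1" "cmod z \<le> 1"
  shows "1 - (pseudohyp a z)^2 = (1 - (cmod a)^2) * (1 - (cmod z)^2) / (cmod (1 - cnj a * z))^2"
proof -
  have "(cmod (1 - cnj a * z))^2 - (cmod (z - a))^2 = (1 - (cmod a)^2) * (1 - (cmod z)^2)"
    unfolding cmod_power2 by (simp add: power2_eq_square) algebra
  then show ?thesis
    using one_minus_cnj_mult_neq_0[OF assms] by (simp add: pseudohyp_def power_divide field_simps)
qed

lemma pseudohyp_eq_1:
  assumes "cmod a < 1" "cmod z = 1" shows "pseudohyp a z = 1"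
proof -
  have "1 - (pseudohyp a z)^2 = 0" using one_minus_pseudohyp_power2[of a z] assms by simp
  then show ?thesis using pseudohyp_nonneg[of a z] by (simp add: power2_eq_1_iff)
qed

lemma pseudohyp_less_1:
  assumes "cmod a < 1" "cmod z < 1" shows "pseudohyp a z < 1"
proof -
  have "(cmod a)^2 < 1" "(cmod z)^2 < 1" using assms by (auto simp: power_less_one_iff)
  then have "1 - (pseudohyp a z)^2 > 0"
    using one_minus_pseudohyp_power2[of a z] one_minus_cnj_mult_neq_0[of a z] assms by simp
  then show ?thesis using pseudohyp_nonneg[of a z] by (simp add: power_less_one_iff)
qed

lemma cmod_diff_le_pseudohyp:
  assumes "cmod a < 1" "cmod z \<le> 1"
  shows "cmod (z - a) \<le> 2 * pseudohyp a z"
proof -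
  have "cmod (1 - cnj a * z) \<le> 1 + cmod a * cmod z"
    by (metis complex_mod_cnj norm_mult norm_one norm_triangle_ineq4)
  also have "\<dots> \<le> 1 + 1 * 1" using assms by (intro add_mono mult_mono) auto
  finally have "cmod (1 - cnj a * z) * pseudohyp a z \<le> 2 * pseudohyp a z"
    using pseudohyp_nonneg by (intro mult_right_mono) auto
  then show ?thesis using one_minus_cnj_mult_neq_0[OF assms] by (simp add: pseudohyp_def)
qed

lemma harmonic_on_ln_pseudohyp:
  assumes "cmod a < 1"
  shows "harmonic_on (ball 0 1 - {a}) (\<lambda>z. ln (pseudohyp a z))"
proof -
  let ?S = "ball (0::complex) 1 - {a}"
  have o: "open ?S" by auto
  have "harmonic_on ?S (\<lambda>z. ln (cmod (z - a)))"
    by (rule harmonic_on_ln_norm[OF o, where F' = "\<lambda>_. 1" and F'' = "\<lambda>_. 0"])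
       (auto intro!: derivative_eq_intros)
  moreover have "harmonic_on ?S (\<lambda>z. ln (cmod (1 - cnj a * z)))"
    by (rule harmonic_on_ln_norm[OF o, where F' = "\<lambda>_. - cnj a" and F'' = "\<lambda>_. 0"])
       (use one_minus_cnj_mult_neq_0[OF assms] in \<open>auto intro!: derivative_eq_intros\<close>)
  ultimately have "harmonic_on ?S (\<lambda>z. ln (cmod (z - a)) - ln (cmod (1 - cnj a * z)))"
    using harmonic_on_diff[OF o] by blast
  moreover have "ln (pseudohyp a z) = ln (cmod (z - a)) - ln (cmod (1 - cnj a * z))" if "z \<in> ?S" for z
    using that one_minus_cnj_mult_neq_0[OF assms, of z] by (simp add: pseudohyp_def ln_div)
  ultimately show ?thesis using harmonic_on_cong[OF o] by (metis (no_types, lifting))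
qed

text \<open>On the unit circle \<open>pseudohyp a\<close> is 1, so a sublevel set taken in the
  closed disc stays away from it. Such sets confine the superlevel sets in the comparison
  arguments.\<close>

lemma compact_pseudohyp_le:
  assumes "cmod a < 1" "\<theta> < 1"
  shows "compact {z \<in> cball 0 1. pseudohyp a z \<le> \<theta>}" "{z \<in> cball 0 1. pseudohyp a z \<le> \<theta>} \<subseteq> ball 0 1"
proof -
  have "closed {z \<in> cball 0 1. pseudohyp a z \<le> \<theta>}"
    by (intro continuous_on_closed_Collect_le continuous_on_pseudohyp assms continuous_intros) auto
  moreover have "bounded {z \<in> cball 0 1. pseudohyp a z \<le> \<theta>}"
    by (rule bounded_subset[OF bounded_cball[of 0 1]]) auto
  ultimately show "compact {z \<in> cball 0 1. pseudohyp a z \<le> \<theta>}"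
    by (simp add: compact_eq_bounded_closed)
  show "{z \<in> cball 0 1. pseudohyp a z \<le> \<theta>} \<subseteq> ball 0 1"
    using pseudohyp_eq_1[OF assms(1)] assms(2) by (force simp: less_le)
qed

text \<open>The logarithm of \<open>pole_cutoff (|y - x|\<^sup>2 / d\<^sup>2)\<close> has a logarithmic pole at \<open>x\<close> and vanishes off the
  ball of radius \<open>d\<close>; it is \<open>C\<^sup>1\<close> away from \<open>x\<close>, as \<open>ln t + 1 - t\<close> vanishes to second order at \<open>1\<close>.\<close>

definition pole_cutoff :: "real \<Rightarrow> real" where
  "pole_cutoff t = (if t \<le> 1 then t * exp (1 - t) else 1)"

lemma pole_cutoff_le_1: "pole_cutoff t \<le> 1"
proof -
  have "t * exp (1 - t) \<le> exp (t - 1) * exp (1 - t)"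
    using exp_ge_add_one_self[of "t - 1"] by (intro mult_right_mono) auto
  then show ?thesis by (simp add: pole_cutoff_def flip: exp_add)
qed

lemma pole_cutoff_pos: "t > 0 \<Longrightarrow> pole_cutoff t > 0"
  by (simp add: pole_cutoff_def)

lemma pole_cutoff_0 [simp]: "pole_cutoff 0 = 0"
  by (simp add: pole_cutoff_def)

lemma pole_cutoff_ge_min: "t \<ge> 0 \<Longrightarrow> min t 1 \<le> pole_cutoff t"
  by (auto simp: pole_cutoff_def mult_le_cancel_left1)

lemma pole_cutoff_le: "t \<ge> 0 \<Longrightarrow> pole_cutoff t \<le> 3 * t"
proof (cases "t \<le> 1")
  case True
  assume "t \<ge> 0"
  have "exp (1 - t) \<le> exp 1" using \<open>t \<ge> 0\<close> by simp
  then have "exp (1 - t) \<le> 3" using exp_le by linarith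
  then have "t * exp (1 - t) \<le> t * 3" using \<open>t \<ge> 0\<close> by (intro mult_left_mono)
  then show ?thesis using True by (simp add: pole_cutoff_def)
qed (simp add: pole_cutoff_def)

lemma ln_pole_cutoff: "0 < t \<Longrightarrow> t \<le> 1 \<Longrightarrow> ln (pole_cutoff t) = ln t + 1 - t"
  by (simp add: pole_cutoff_def ln_mult_pos)

text \<open>Beyond 1 the formula of the inner branch is at most 0, by ln t \<le> t - 1. It therefore
  supports the cutoff from below even at the seam \<open>t = 1\<close>.\<close>

lemma ln_pole_cutoff_ge: "0 < t \<Longrightarrow> ln t + 1 - t \<le> ln (pole_cutoff t)"
  using ln_le_minus_one[of t] by (cases "t \<le> 1") (auto simp: ln_pole_cutoff, auto simp: pole_cutoff_def)

lemma continuous_on_pole_cutoff: "continuous_on UNIV pole_cutoff"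
proof -
  have "continuous_on ({..1} \<union> {1..}) (\<lambda>t::real. if t \<le> 1 then t * exp (1 - t) else 1)"
    by (intro continuous_on_cases continuous_intros) auto
  moreover have "{..1} \<union> {1..} = (UNIV :: real set)" by auto
  ultimately show ?thesis by (simp add: pole_cutoff_def[abs_def])
qed

text \<open>The logarithm of the distance costs nothing; the whole loss comes from the term - t of
  the inner branch. Beyond the cutoff radius the function is locally constant.\<close>

lemma lower_support_ln_pole_cutoff:
  fixes f :: "complex \<Rightarrow> 'a::euclidean_space"
  assumes D: "open D" "z \<in> D" and conf: "conformal_on D f" and harm: "harmonic_on D f"
    and "f z \<noteq> x" "d > 0" "e > 0"
  defines "t \<equiv> \<lambda>w. (norm (f w - x))^2 / d^2"
  shows "lower_support (- ((norm (pdx f z))^2) / d^2 - e) (\<lambda>w. ln (pole_cutoff (t w))) z"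
    and "t z > 1 \<Longrightarrow> lower_support 0 (\<lambda>w. ln (pole_cutoff (t w))) z"
proof -
  have "isCont f z"
    using has_partials_eq(1)[OF partials_at(1)[OF D conf harm]] by (rule differentiable_imp_continuous_within)
  then have ct: "isCont t z" unfolding t_def using \<open>d > 0\<close> by (intro continuous_intros) auto
  have tz: "t z > 0" using assms by (simp add: t_def)
  have lim: "(t \<longlongrightarrow> t z) (nhds z)"
    using ct tendsto_at_iff_tendsto_nhds[of t z] by (simp add: isCont_def)
  show *: "lower_support 0 (\<lambda>w. ln (pole_cutoff (t w))) z" if "t z > 1"
  proof (rule lower_support_mono[OF lower_support_harmonic[OF open_UNIV UNIV_I harmonic_on_const[OF open_UNIV, of 0]]])
    have "\<forall>\<^sub>F w in nhds z. t w > 1" using order_tendstoD(1)[OF lim that] .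
    then show "\<forall>\<^sub>F w in nhds z. 0 \<le> ln (pole_cutoff (t w))"
      by eventually_elim (simp add: pole_cutoff_def)
    show "ln (pole_cutoff (t z)) = 0" using that by (simp add: pole_cutoff_def)
  qed simp
  show "lower_support (- ((norm (pdx f z))^2) / d^2 - e) (\<lambda>w. ln (pole_cutoff (t w))) z"
  proof (cases "t z > 1")
    case True
    show ?thesis
    proof (rule lower_support_mono[OF *[OF True]])
      have "(norm (pdx f z))^2 / d^2 \<ge> 0" by simp
      then show "- ((norm (pdx f z))^2) / d^2 - e \<le> 0"
        using \<open>e > 0\<close> unfolding minus_divide_left[symmetric] by linarith
    qed auto
  next
    case False
    define e' where "e' = e / 2"
    define e'' where "e'' = d^2 * e / 2"
    have e': "e' > 0" "e'' > 0" using assms by (auto simp: e'_def e''_def)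
    have "lower_support (- e' + (1 / d^2) * (- ((norm (pdx f z))^2) - e'') + 0)
      (\<lambda>w. ln ((norm (f w - x))^2) + (1 / d^2) * (- ((norm (f w - x))^2)) + (1 - ln (d^2))) z"
      by (intro lower_support_add lower_support_mult lower_support_ln_dist_power2[OF D conf harm]
          lower_support_neg_dist_power2[OF D conf harm]
          lower_support_harmonic[OF open_UNIV UNIV_I harmonic_on_const[OF open_UNIV]] e' \<open>f z \<noteq> x\<close>) simp
    moreover have "- e' + (1 / d^2) * (- ((norm (pdx f z))^2) - e'') + 0 = - ((norm (pdx f z))^2) / d^2 - e"
      using \<open>d > 0\<close> by (simp add: e'_def e''_def field_simps)
    ultimately have s: "lower_support (- ((norm (pdx f z))^2) / d^2 - e)
      (\<lambda>w. ln ((norm (f w - x))^2) + (1 / d^2) * (- ((norm (f w - x))^2)) + (1 - ln (d^2))) z"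
      by simp
    have eq: "ln ((norm (f w - x))^2) + (1 / d^2) * (- ((norm (f w - x))^2)) + (1 - ln (d^2)) = ln (t w) + 1 - t w"
      if "t w > 0" for w
    proof -
      have "(norm (f w - x))^2 > 0" using that \<open>d > 0\<close> by (auto simp: t_def zero_less_divide_iff)
      then have "ln (t w) = ln ((norm (f w - x))^2) - ln (d^2)"
        unfolding t_def using \<open>d > 0\<close> by (subst ln_divide_pos) auto
      then show ?thesis by (simp add: t_def)
    qed
    show ?thesis
    proof (rule lower_support_mono[OF s])
      have "\<forall>\<^sub>F w in nhds z. t w > 0" using order_tendstoD(1)[OF lim tz] .
      then show "\<forall>\<^sub>F w in nhds z. ln ((norm (f w - x))^2) + (1 / d^2) * (- ((norm (f w - x))^2)) + (1 - ln (d^2))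
          \<le> ln (pole_cutoff (t w))"
        by eventually_elim (simp only: eq ln_pole_cutoff_ge)
      show "ln (pole_cutoff (t z)) = ln ((norm (f z - x))^2) + (1 / d^2) * (- ((norm (f z - x))^2)) + (1 - ln (d^2))"
        using eq[OF tz] ln_pole_cutoff[OF tz] False by simp
    qed simp
  qed
qed

section \<open>Localization near a peak point\<close>

lemma le_of_affine_le:
  fixes a b X Y :: real
  assumes "\<And>e. 0 < e \<Longrightarrow> e < 1 \<Longrightarrow> a + e * X \<le> b + e * Y"
  shows "a \<le> b"
proof -
  have "((\<lambda>e. a + e * X) \<longlongrightarrow> a + 0 * X) (at_right 0)" "((\<lambda>e. b + e * Y) \<longlongrightarrow> b + 0 * Y) (at_right 0)"
    by (intro tendsto_intros)+
  moreover have "\<forall>\<^sub>F e in at_right 0. a + e * X \<le> b + e * Y"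
    using eventually_at_right_real[OF zero_less_one] by eventually_elim (use assms in auto)
  ultimately show ?thesis
    using tendsto_le[of "at_right (0::real)"] by fastforce
qed

text \<open>The modulus \<open>\<phi>\<close> is encoded by its consequence \<open>u_far\<close>.
  Estimates proved here contain only \<delta>, \<eta>, \<open>c\<^sub>0\<close> and auxiliary radii,
  so they are uniform over all points \<open>p\<close> that share these parameters.\<close>

locale local_peak_function =
  fixes \<Omega> \<Omega>\<^sub>1 :: "'a::euclidean_space set" and p :: 'a and u :: "'a \<Rightarrow> real" and \<delta> \<eta> c\<^sub>0 :: real
  assumes opens: "open \<Omega>" "open \<Omega>\<^sub>1" and pos: "\<delta> > 0" "\<eta> > 0" "c\<^sub>0 > 0"
    and ball_Int: "ball p \<delta> \<inter> \<Omega> \<subseteq> \<Omega>\<^sub>1"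
    and cont_u: "continuous_on \<Omega>\<^sub>1 u" and mpsh: "MPSH_on \<Omega>\<^sub>1 (\<lambda>x. ereal (u x))"
    and u_le_0: "\<And>y. y \<in> \<Omega>\<^sub>1 \<Longrightarrow> u y \<le> 0"
    and u_ge: "\<And>y. y \<in> \<Omega>\<^sub>1 \<Longrightarrow> c\<^sub>0 * \<bar>u y\<bar> \<le> norm (y - p)"
    and u_far: "\<And>y. y \<in> \<Omega>\<^sub>1 \<Longrightarrow> \<delta> / 2 \<le> norm (y - p) \<Longrightarrow> u y \<le> - \<eta>"
begin

text \<open>The floor \<open>- \<eta> / 2\<close> lies below the values near \<open>p\<close> and
  above those in the outer shell of the ball, where \<open>u\<close> is at most
  \<open>- \<eta>\<close>; so the maximum is already constant before the ball is left.\<close>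

definition glue :: "real \<Rightarrow> 'a \<Rightarrow> real" where
  "glue \<kappa> y = (if y \<in> ball p \<delta> then max (u y + \<kappa> * (norm (y - p))^2) (- \<eta> / 2) else - \<eta> / 2)"

lemma glue_ge: "- \<eta> / 2 \<le> glue \<kappa> y"
  by (auto simp: glue_def)

lemma glue_le:
  assumes "0 \<le> \<kappa>" "y \<in> \<Omega>" shows "glue \<kappa> y \<le> \<kappa> * \<delta>^2"
proof (cases "y \<in> ball p \<delta>")
  case True
  then have "(norm (y - p))^2 \<le> \<delta>^2" by (intro power_mono) (auto simp: dist_norm norm_minus_commute)
  then have "\<kappa> * (norm (y - p))^2 \<le> \<kappa> * \<delta>^2" using assms by (intro mult_left_mono)
  moreover have "u y \<le> 0" using True ball_Int assms(2) u_le_0 by blast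
  moreover have "0 \<le> \<kappa> * \<delta>^2" using assms by simp
  ultimately show ?thesis using True pos by (simp add: glue_def)
next
  case False
  have "0 \<le> \<kappa> * \<delta>^2" using assms by simp
  then show ?thesis using False pos by (auto simp: glue_def)
qed

text \<open>In the shell the unglued branch is at most \<open>- \<eta> + \<eta> / 4\<close>, which
  is below the floor. The two descriptions of \<open>glue\<close> therefore hold on overlapping open
  sets.\<close>

lemma continuous_on_glue:
  assumes "0 \<le> \<kappa>" "\<kappa> * \<delta>^2 \<le> \<eta> / 4"
  shows "continuous_on \<Omega> (glue \<kappa>)"
proof -
  have 1: "continuous_on (\<Omega> \<inter> ball p \<delta>) (glue \<kappa>)"
  proof -
    have "continuous_on (\<Omega> \<inter> ball p \<delta>) (\<lambda>y. max (u y + \<kappa> * (norm (y - p))^2) (- \<eta> / 2))"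
      by (intro continuous_intros continuous_on_subset[OF cont_u]) (use ball_Int in auto)
    then show ?thesis by (rule continuous_on_eq) (simp add: glue_def)
  qed
  have 2: "continuous_on (\<Omega> - cball p (\<delta> / 2)) (glue \<kappa>)"
  proof -
    have "- \<eta> / 2 = glue \<kappa> y" if y: "y \<in> \<Omega> - cball p (\<delta> / 2)" for y
    proof (cases "y \<in> ball p \<delta>")
      case True
      then have "(norm (y - p))^2 \<le> \<delta>^2" by (intro power_mono) (auto simp: dist_norm norm_minus_commute)
      then have "\<kappa> * (norm (y - p))^2 \<le> \<kappa> * \<delta>^2" using assms by (intro mult_left_mono)
      moreover have "u y \<le> - \<eta>"
        using y True ball_Int by (intro u_far) (auto simp: dist_norm norm_minus_commute)
      ultimately have "u y + \<kappa> * (norm (y - p))^2 \<le> - \<eta> / 2" using assms pos by linarith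
      then show ?thesis using True by (simp add: glue_def)
    next
      case False
      then show ?thesis unfolding glue_def by simp
    qed
    then show ?thesis by (intro continuous_on_eq[OF continuous_on_const])
  qed
  have "continuous_on ((\<Omega> \<inter> ball p \<delta>) \<union> (\<Omega> - cball p (\<delta> / 2))) (glue \<kappa>)"
    by (intro continuous_on_open_Un 1 2) (use opens in auto)
  moreover have "(\<Omega> \<inter> ball p \<delta>) \<union> (\<Omega> - cball p (\<delta> / 2)) = \<Omega>" using pos by auto
  ultimately show ?thesis by simp
qed

text \<open>Compact superlevel sets above \<open>M0\<close> provide a maximum point, taking the
  place of boundary values. Where the branch with \<open>u\<close> is active there, the maximum
  principle for MPSH functions applies; where the floor is active, \<open>H\<close> alone would have
  a local maximum.\<close>

lemma glue_max_principle:
  assumes S: "open S" and conf: "conformal_on S f" and harm: "harmonic_on S f" and fS: "f ` S \<subseteq> \<Omega>"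
    and H: "continuous_on S H" and c: "c > 0"
    and near: "\<And>z. z \<in> S \<Longrightarrow> f z \<in> ball p \<delta> \<Longrightarrow> lower_support c (\<lambda>w. \<kappa> * (norm (f w - p))^2 + H w) z"
    and far: "\<And>z. z \<in> S \<Longrightarrow> glue \<kappa> (f z) = - \<eta> / 2 \<Longrightarrow> lower_support c H z"
    and cpt: "\<And>M. M > M0 \<Longrightarrow> compact {z \<in> S. M \<le> glue \<kappa> (f z) + H z}"
    and \<kappa>: "0 \<le> \<kappa>" "\<kappa> * \<delta>^2 \<le> \<eta> / 4"
    and z: "z \<in> S"
  shows "glue \<kappa> (f z) + H z \<le> M0"
proof (rule ccontr)
  define W where "W = (\<lambda>z. glue \<kappa> (f z) + H z)"
  assume "\<not> glue \<kappa> (f z) + H z \<le> M0"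
  then have "W z > M0" by (simp add: W_def)
  have contf: "continuous_on S f" by (rule harmonic_on_continuous_on[OF harm])
  have "continuous_on S W"
    unfolding W_def by (intro continuous_intros continuous_on_compose2[OF continuous_on_glue[OF \<kappa>] contf fS] H)
  then have "continuous_on {w \<in> S. W z \<le> W w} W" by (rule continuous_on_subset) auto
  then obtain z0 where z0: "z0 \<in> S" "W z \<le> W z0" "\<And>w. w \<in> S \<Longrightarrow> W z \<le> W w \<Longrightarrow> W w \<le> W z0"
    using continuous_attains_sup[of "{w \<in> S. W z \<le> W w}" W] cpt[OF \<open>W z > M0\<close>] z
    unfolding W_def by blast
  have max: "W w \<le> W z0" if "w \<in> S" for w
    using z0(2,3) that by (meson le_cases order_trans)
  show False
  \<comment> \<open>In the first case the unglued function is at most the glued one near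
    \<open>z0\<close> and equal to it at \<open>z0\<close>, so it inherits the maximum.\<close>
  proof (cases "f z0 \<in> ball p \<delta> \<and> - \<eta> / 2 \<le> u (f z0) + \<kappa> * (norm (f z0 - p))^2")
    case True
    define S' where "S' = S \<inter> f -` ball p \<delta>"
    have S': "open S'" "S' \<subseteq> S"
      unfolding S'_def using continuous_open_preimage[OF contf S open_ball] by auto
    have fS': "f ` S' \<subseteq> \<Omega>\<^sub>1" using fS ball_Int by (auto simp: S'_def)
    have conf': "conformal_on S' f"
      using conf S'(2) unfolding conformal_on_def C1_on_def by (meson continuous_on_subset subsetD)
    show False
    proof (rule MPSH_conformal_harmonic_no_local_max[OF S'(1) _ conf' harmonic_on_subset[OF harm S'(2)] fS'
          opens(2) cont_u mpsh _ c])
      show "z0 \<in> S'" using z0 True by (simp add: S'_def)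
      show "continuous_on S' (\<lambda>w. \<kappa> * (norm (f w - p))^2 + H w)"
        by (intro continuous_intros continuous_on_subset[OF contf S'(2)] continuous_on_subset[OF H S'(2)])
      show "lower_support c (\<lambda>w. \<kappa> * (norm (f w - p))^2 + H w) w" if "w \<in> S'" for w
        using near that by (auto simp: S'_def)
      show "u (f w) + (\<kappa> * (norm (f w - p))^2 + H w) \<le> u (f z0) + (\<kappa> * (norm (f z0 - p))^2 + H z0)"
        if "w \<in> S'" for w
      proof -
        have "f w \<in> ball p \<delta>" using that by (simp add: S'_def)
        then have "u (f w) + \<kappa> * (norm (f w - p))^2 \<le> glue \<kappa> (f w)" by (simp add: glue_def)
        moreover have "glue \<kappa> (f z0) = u (f z0) + \<kappa> * (norm (f z0 - p))^2" using True by (simp add: glue_def)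
        moreover have "W w \<le> W z0" using max that S' by blast
        ultimately show ?thesis by (simp add: W_def)
      qed
    qed
  next
    case False
    then have g: "glue \<kappa> (f z0) = - \<eta> / 2" by (auto simp: glue_def)
    have "\<forall>\<^sub>F w in nhds z0. w \<in> S" using S z0(1) by (rule eventually_nhds_in_open)
    then have "\<forall>\<^sub>F w in nhds z0. H w \<le> H z0"
    proof eventually_elim
      case (elim w)
      then show ?case using max[OF elim] glue_ge[of \<kappa> "f w"] by (simp add: W_def g)
    qed
    then show False using lower_support_no_local_max[OF far[OF z0(1) g] c] by blast
  qed
qed

text \<open>Within \<open>2 * d\<close> of \<open>p\<close>, \<open>u_ge\<close> gives |u| at most
  \<open>2 * d / c\<^sub>0\<close>, hence at most \<open>\<eta> / 4\<close>. So the floor is active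
  only farther away, where a cutoff of radius \<open>d\<close> centred within \<open>d\<close> of
  \<open>p\<close> is constant and needs no compensation.\<close>

lemma glue_gt:
  assumes "8 * d \<le> c\<^sub>0 * \<eta>" "4 * d \<le> \<delta>" "d > 0" "0 \<le> \<kappa>" "y \<in> \<Omega>" "norm (y - p) \<le> 2 * d"
  shows "- \<eta> / 2 < glue \<kappa> y"
proof -
  have y: "y \<in> ball p \<delta>" using assms by (simp add: dist_norm norm_minus_commute)
  then have "y \<in> \<Omega>\<^sub>1" using assms ball_Int by blast
  from u_ge[OF this] have "c\<^sub>0 * \<bar>u y\<bar> < c\<^sub>0 * (\<eta> / 2)" using assms by linarith
  then have "\<bar>u y\<bar> < \<eta> / 2" using pos by simp
  moreover have "\<kappa> * (norm (y - p))^2 \<ge> 0" using assms by simp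
  ultimately show ?thesis using y by (simp add: glue_def)
qed

text \<open>Sibony's method: \<open>exp (glue / B) \<cdot> pole_cutoff (|y - f z\<^sub>1|\<^sup>2 / d\<^sup>2)\<close> is a bounded function whose
  logarithm is MPSH with a logarithmic pole at \<open>f z\<^sub>1\<close>, the strictly MPSH term \<open>\<kappa> |y - p|\<^sup>2\<close> in \<open>glue\<close>
  compensating for the cutoff. It is compared with the square of the pseudohyperbolic distance.\<close>

lemma pole_cutoff_le_pseudohyp:
  assumes f: "f \<in> CH (ball 0 1) \<Omega>" and z1: "cmod z1 < 1" "norm (f z1 - p) \<le> d"
    and d: "d > 0" "8 * d \<le> c\<^sub>0 * \<eta>" "4 * d \<le> \<delta>" and z: "cmod z < 1"
  shows "pole_cutoff ((norm (f z - f z1))^2 / d^2) \<le> exp (3 * \<delta>^2 / d^2) * (pseudohyp z1 z)^2"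
proof (cases "f z = f z1")
  case True
  then show ?thesis by simp
next
  case ne: False
  define x where "x = f z1"
  define t where "t = (\<lambda>w. (norm (f w - x))^2 / d^2)"
  \<comment> \<open>The largest value compatible with continuity of \<open>glue\<close>.\<close>
  define \<kappa> where "\<kappa> = \<eta> / (4 * \<delta>^2)"
  \<comment> \<open>With this weight the loss |f_x|^2 / d^2 of the cutoff cancels the gain \<kappa>
    |f_x|^2.\<close>
  define B where "B = \<kappa> * d^2"
  define S where "S = {w \<in> ball 0 1. f w \<noteq> x}"
  have \<kappa>: "\<kappa> > 0" "\<kappa> * \<delta>^2 = \<eta> / 4" using pos by (auto simp: \<kappa>_def)
  have B: "B > 0" "B / d^2 = \<kappa>" using \<kappa> d by (auto simp: B_def)
  have harm1: "harmonic_on (ball 0 1) f" and conf1: "conformal_on (ball 0 1) f" and im: "f ` ball 0 1 \<subseteq> \<Omega>"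
    using f by (auto simp: CH_def)
  have contf: "continuous_on (ball 0 1) f" by (rule harmonic_on_continuous_on[OF harm1])
  have Seq: "S = ball 0 1 \<inter> f -` (- {x})" by (auto simp: S_def)
  have S: "open S" unfolding Seq by (rule continuous_open_preimage[OF contf]) auto
  have Ssub: "S \<subseteq> ball 0 1 - {z1}" by (auto simp: S_def x_def)
  have harm: "harmonic_on S f" by (rule harmonic_on_subset[OF harm1]) (use Ssub in auto)
  have conf: "conformal_on S f"
    using conf1 Ssub unfolding conformal_on_def C1_on_def by (meson Diff_subset continuous_on_subset subset_trans subsetD)
  have fS: "f ` S \<subseteq> \<Omega>" using im Ssub by auto
  have tpos: "t w > 0" if "w \<in> S" for w using that d by (simp add: t_def S_def)
  have pd: "pseudohyp z1 w > 0" if "w \<in> S" for w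
    using pseudohyp_pos[OF z1(1), of w] subsetD[OF Ssub that] by auto
  have zS: "z \<in> S" using z ne by (simp add: S_def x_def)
  \<comment> \<open>Lowering the coefficient 2 of \<open>ln (pseudohyp z1 z)\<close> to
    \<open>2 - e\<close> sends the sum to minus infinity at \<open>z1\<close>, and
    \<open>e * (cmod z)^2\<close> supplies strictness. Both corrections vanish as \<open>e\<close>
    tends to 0.\<close>
  have *: "(glue \<kappa> (f z) + B * (ln (pole_cutoff (t z)) - 2 * ln (pseudohyp z1 z))) +
      e * (B * (ln (pseudohyp z1 z) + (cmod z)^2)) \<le> \<eta> / 4 + e * B" if e: "0 < e" "e < 1" for e
  proof -
    define H where "H = (\<lambda>w. B * (ln (pole_cutoff (t w)) + (e - 2) * ln (pseudohyp z1 w) + e * (cmod w)^2))"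
    define c where "c = B * e / 2"
    have harm_pd: "harmonic_on S (\<lambda>w. (e - 2) * ln (pseudohyp z1 w))"
      by (intro harmonic_on_cmult S harmonic_on_subset[OF harmonic_on_ln_pseudohyp[OF z1(1)] Ssub])
    have ls_rest: "lower_support (0 + e * 1) (\<lambda>w. (e - 2) * ln (pseudohyp z1 w) + e * (cmod w)^2) w" if "w \<in> S" for w
      by (intro lower_support_add lower_support_mult lower_support_cmod_power2
          lower_support_harmonic[OF S that harm_pd]) (use e in simp)
    have contH: "continuous_on S H"
      unfolding H_def t_def
      by (intro continuous_intros continuous_on_compose2[OF continuous_on_pole_cutoff]
          harmonic_on_continuous_on[OF harm_pd] continuous_on_subset[OF contf])
         (use Ssub d tpos pole_cutoff_pos in \<open>auto simp: t_def less_le\<close>)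
    have "glue \<kappa> (f z) + H z \<le> \<eta> / 4 + B * e"
    proof (rule glue_max_principle[OF S conf harm fS contH _ _ _ _ _ _ zS])
      show "c > 0" using B e by (simp add: c_def)
      show "0 \<le> \<kappa>" "\<kappa> * \<delta>\<^sup>2 \<le> \<eta> / 4" using \<kappa> by auto
      show "lower_support c (\<lambda>w. \<kappa> * (norm (f w - p))\<^sup>2 + H w) w" if w: "w \<in> S" for w
      proof -
        \<comment> \<open>Chosen so that the expansion errors use up exactly half of the strictness
          \<open>B * e\<close>, leaving \<open>c\<close>.\<close>
        define e1 where "e1 = c / (\<kappa> + B)"
        have e1: "e1 > 0" using \<open>c > 0\<close> \<kappa> B by (simp add: e1_def)
        define a where "a = (norm (pdx f w))^2"
        have "lower_support (\<kappa> * (a - e1) + B * ((- a / d^2 - e1) + (0 + e * 1)))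
          (\<lambda>w. \<kappa> * (norm (f w - p))\<^sup>2 + B * (ln (pole_cutoff (t w)) + ((e - 2) * ln (pseudohyp z1 w) + e * (cmod w)^2))) w"
          unfolding a_def t_def
          by (intro lower_support_add[OF lower_support_mult[OF lower_support_dist_power2[OF S w conf harm e1]]
                lower_support_mult[OF lower_support_add[OF lower_support_ln_pole_cutoff(1)[OF S w conf harm _ d(1) e1] ls_rest[OF w]]]])
             (use \<kappa> B w in \<open>auto simp: S_def\<close>)
        moreover have "\<kappa> * (a - e1) + B * ((- a / d^2 - e1) + (0 + e * 1)) = c"
        proof -
          have "B * (a / d^2) = \<kappa> * a" unfolding B(2)[symmetric] by simp
          moreover have "(\<kappa> + B) * e1 = c" using \<kappa> B by (simp add: e1_def)
          ultimately show ?thesis by (simp add: c_def algebra_simps)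
        qed
        ultimately show ?thesis by (simp add: H_def add.assoc)
      qed
      show "lower_support c H w" if w: "w \<in> S" and g: "glue \<kappa> (f w) = - \<eta> / 2" for w
      proof -
        have fw: "f w \<in> \<Omega>" using fS w by auto
        have "\<not> norm (f w - p) \<le> 2 * d"
          using glue_gt[OF d(2,3,1) less_imp_le[OF \<kappa>(1)] fw] g by linarith
        then have "norm (f w - x) > d"
          using z1(2) norm_triangle_ineq[of "f w - x" "x - p"] by (simp add: x_def)
        then have "(norm (f w - x))^2 > d^2" using d by (intro power_strict_mono) auto
        then have "t w > 1" using d by (simp add: t_def)
        have "lower_support (B * (0 + (0 + e * 1)))
           (\<lambda>w. B * (ln (pole_cutoff (t w)) + ((e - 2) * ln (pseudohyp z1 w) + e * (cmod w)^2))) w"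
          unfolding t_def
          by (rule lower_support_mult[OF lower_support_add[OF lower_support_ln_pole_cutoff(2)[OF S w conf harm _ d(1) e(1)] ls_rest[OF w]]])
             (use B w \<open>t w > 1\<close> in \<open>auto simp: S_def t_def\<close>)
        then have "lower_support (B * e) H w" by (simp add: H_def add.assoc)
        then show ?thesis
          by (rule lower_support_mono) (use B e in \<open>auto simp: c_def\<close>)
      qed
      show "compact {w \<in> S. M \<le> glue \<kappa> (f w) + H w}" if M: "\<eta> / 4 + B * e < M" for M
      proof -
        \<comment> \<open>Solves \<open>M = \<eta> / 4 + B * e - 2 * B * ln \<theta>\<close>, where
          the right-hand side bounds the sum at points of pseudohyperbolic distance \<theta> from
          \<open>z1\<close>.\<close>
        define \<theta> where "\<theta> = exp (- ((M - \<eta> / 4 - B * e) / (2 * B)))"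
        have \<theta>: "\<theta> < 1" using M B by (simp add: \<theta>_def)
        have glue_w: "glue \<kappa> (f w) \<le> \<eta> / 4" if "w \<in> ball 0 1" for w
          using glue_le[OF less_imp_le[OF \<kappa>(1)] subsetD[OF im imageI[OF that]]] \<kappa>(2) by linarith
        have esq: "e * (cmod w)^2 \<le> e" if "w \<in> ball 0 1" for w
        proof -
          have "(cmod w)^2 \<le> 1" using that by (simp add: power_le_one)
          then show ?thesis using e by (simp add: mult_left_le)
        qed
        have le\<theta>: "pseudohyp z1 w \<le> \<theta>" if w: "w \<in> S" and Mw: "M \<le> glue \<kappa> (f w) + H w" for w
        proof -
          have wb: "w \<in> ball 0 1" using w Ssub by auto
          have lp: "ln (pseudohyp z1 w) \<le> 0" using pseudohyp_less_1[OF z1(1), of w] pd[OF w] wb by simp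
          have "ln (pole_cutoff (t w)) \<le> 0" using pole_cutoff_le_1 pole_cutoff_pos[OF tpos[OF w]] by simp
          moreover have "(e - 2) * ln (pseudohyp z1 w) \<le> - 2 * ln (pseudohyp z1 w)"
            using e lp by (simp add: algebra_simps mult_nonneg_nonpos)
          ultimately have "ln (pole_cutoff (t w)) + (e - 2) * ln (pseudohyp z1 w) + e * (cmod w)^2
             \<le> - 2 * ln (pseudohyp z1 w) + e" using esq[OF wb] by linarith
          then have "H w \<le> B * (- 2 * ln (pseudohyp z1 w) + e)"
            unfolding H_def using B by (intro mult_left_mono) auto
          then have "2 * B * ln (pseudohyp z1 w) \<le> - (M - \<eta> / 4 - B * e)"
            using Mw glue_w[OF wb] by (simp add: algebra_simps)
          then have "ln (pseudohyp z1 w) \<le> - ((M - \<eta> / 4 - B * e) / (2 * B))"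
            using B by (simp add: field_simps)
          then show ?thesis unfolding \<theta>_def using pd[OF w] by (simp add: ln_ge_iff flip: ln_le_cancel_iff)
        qed
        \<comment> \<open>Near \<open>z1\<close> the cutoff is at most a multiple of the squared
          pseudohyperbolic distance. After cancellation a term
          \<open>e * ln (pseudohyp z1 w)\<close> remains, which tends to minus infinity.\<close>
        obtain \<sigma> where \<sigma>: "\<sigma> > 0" "\<And>w. w \<in> S \<Longrightarrow> dist w z1 < \<sigma> \<Longrightarrow> glue \<kappa> (f w) + H w < M"
        proof -
          have z1b: "z1 \<in> ball 0 1" using z1 by simp
          have part: "has_partials f (pdx f z1) (pdy f z1) z1" using harmonic_onD(1)[OF harm1 z1b] .
          define C where "C = norm (pdx f z1) + norm (pdy f z1) + 1"
          have C: "C > 0" by (simp add: C_def add_nonneg_pos)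
          \<comment> \<open>The 12 is the 3 of \<open>pole_cutoff_le\<close> times the square of the
            2 in \<open>cmod_diff_le_pseudohyp\<close>.\<close>
          define C' where "C' = 12 * C^2 / d^2"
          have C': "C' > 0" using C d by (simp add: C'_def)
          define \<theta>1 where "\<theta>1 = exp ((M - \<eta> / 4 - B * (ln C' + e)) / (B * e))"
          have "\<forall>\<^sub>F w in nhds z1. norm (f w - f z1) \<le> C * cmod (w - z1)"
            using has_partials_remainder[OF part zero_less_one]
          proof eventually_elim
            case (elim w)
            have "norm (f w - f z1) \<le> norm (f w - f z1 - (Re (w - z1) *\<^sub>R pdx f z1 + Im (w - z1) *\<^sub>R pdy f z1))
               + norm (Re (w - z1) *\<^sub>R pdx f z1 + Im (w - z1) *\<^sub>R pdy f z1)"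
              using norm_triangle_ineq by (metis diff_add_cancel)
            also have "\<dots> \<le> 1 * cmod (w - z1) + (norm (pdx f z1) + norm (pdy f z1)) * cmod (w - z1)"
              by (intro add_mono elim norm_partials_le)
            finally show ?case by (simp add: C_def algebra_simps)
          qed
          moreover have "\<forall>\<^sub>F w in nhds z1. pseudohyp z1 w < \<theta>1"
          proof -
            have "continuous_on (ball 0 1) (pseudohyp z1)"
              using continuous_on_subset[OF continuous_on_pseudohyp[OF z1(1)] ball_subset_cball] .
            then have "isCont (pseudohyp z1) z1"
              using z1b continuous_on_eq_continuous_at[OF open_ball] by blast
            then have "((pseudohyp z1) \<longlongrightarrow> pseudohyp z1 z1) (nhds z1)"
              using tendsto_at_iff_tendsto_nhds[of "pseudohyp z1" z1] by (simp only: isCont_def)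
            then show ?thesis by (rule order_tendstoD) (simp add: \<theta>1_def)
          qed
          ultimately have "\<forall>\<^sub>F w in nhds z1. w \<in> S \<longrightarrow> glue \<kappa> (f w) + H w < M"
          proof eventually_elim
            case (elim w)
            show ?case
            proof
              assume w: "w \<in> S"
              then have wb: "w \<in> ball 0 1" using Ssub by auto
              have "norm (f w - x) \<le> C * (2 * pseudohyp z1 w)"
                using elim(1) cmod_diff_le_pseudohyp[OF z1(1), of w] wb C unfolding x_def
                by (smt (verit, best) mult_left_mono mem_ball_0)
              then have "(norm (f w - x))^2 \<le> (C * (2 * pseudohyp z1 w))^2" by (intro power_mono) auto
              then have "3 * t w \<le> C' * (pseudohyp z1 w)^2"
                using d by (simp add: t_def C'_def power_mult_distrib divide_right_mono field_simps)
              then have "pole_cutoff (t w) \<le> C' * (pseudohyp z1 w)^2"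
                using pole_cutoff_le[of "t w"] tpos[OF w] by linarith
              then have "ln (pole_cutoff (t w)) \<le> ln (C' * (pseudohyp z1 w)^2)"
                using pole_cutoff_pos[OF tpos[OF w]] C' pd[OF w] by simp
              also have "\<dots> = ln C' + 2 * ln (pseudohyp z1 w)"
                using C' pd[OF w] by (simp add: ln_mult_pos ln_realpow)
              finally have "H w \<le> B * (ln C' + e + e * ln (pseudohyp z1 w))"
                unfolding H_def using B esq[OF wb] by (intro mult_left_mono) (auto simp: algebra_simps)
              moreover have "ln (pseudohyp z1 w) < (M - \<eta> / 4 - B * (ln C' + e)) / (B * e)"
                using elim(2) pd[OF w] unfolding \<theta>1_def by (metis exp_less_cancel_iff exp_ln)
              then have "B * e * ln (pseudohyp z1 w) < M - \<eta> / 4 - B * (ln C' + e)"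
                using B e by (simp add: field_simps)
              ultimately show "glue \<kappa> (f w) + H w < M"
                using glue_w[OF wb] by (simp add: algebra_simps)
            qed
          qed
          then show thesis using that by (auto simp: eventually_nhds_metric)
        qed
        define K where "K = {w \<in> cball 0 1. pseudohyp z1 w \<le> \<theta>} - ball z1 \<sigma>"
        have K: "compact K" "K \<subseteq> ball 0 1" "K \<subseteq> cball 0 1"
          using compact_pseudohyp_le[OF z1(1) \<theta>] by (auto simp: K_def intro: compact_diff)
        have Kpd: "pseudohyp z1 w > 0" if "w \<in> K" for w
          using that K \<sigma>(1) by (intro pseudohyp_pos[OF z1(1)]) (auto simp: K_def)
        \<comment> \<open>\<open>K\<close> may contain further points where \<open>f\<close> takes
          the value \<open>x\<close>, and there the logarithm in \<open>H\<close> has only a default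
          value. The exponential form extends continuously by 0 to them, so its superlevel sets are
          closed and avoid these points.\<close>
        define E where "E = (\<lambda>w. pole_cutoff (t w) * exp (glue \<kappa> (f w) / B + (e - 2) * ln (pseudohyp z1 w) + e * (cmod w)^2))"
        have contE: "continuous_on K E"
          unfolding E_def t_def
          by (intro continuous_intros continuous_on_compose2[OF continuous_on_pole_cutoff]
              continuous_on_compose2[OF continuous_on_glue]
              continuous_on_subset[OF contf K(2)] continuous_on_subset[OF continuous_on_pseudohyp[OF z1(1)] K(3)])
             (use K im d B \<kappa> Kpd in \<open>auto simp: less_le\<close>)
        have Eexp: "E w = exp ((glue \<kappa> (f w) + H w) / B)" if "w \<in> S" for w
        proof -
          have "(glue \<kappa> (f w) + H w) / B = ln (pole_cutoff (t w)) + (glue \<kappa> (f w) / B + (e - 2) * ln (pseudohyp z1 w) + e * (cmod w)^2)"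
            using B by (simp add: H_def add_divide_distrib)
          then show ?thesis using pole_cutoff_pos[OF tpos[OF that]] by (simp add: E_def exp_add)
        qed
        have "{w \<in> S. M \<le> glue \<kappa> (f w) + H w} = {w \<in> K. exp (M / B) \<le> E w}"
        proof safe
          fix w assume w: "w \<in> S" "M \<le> glue \<kappa> (f w) + H w"
          show "w \<in> K" using le\<theta>[OF w] \<sigma>(2)[OF w(1)] w Ssub by (force simp: K_def dist_commute)
          show "exp (M / B) \<le> E w" using w B by (simp add: Eexp divide_right_mono)
        next
          fix w assume w: "w \<in> K" "exp (M / B) \<le> E w"
          have "E w > 0" using w(2) exp_gt_zero less_le_trans by blast
          then have "pole_cutoff (t w) > 0" by (simp add: E_def zero_less_mult_iff)
          then have "f w \<noteq> x" by (auto simp: t_def)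
          then show wS: "w \<in> S" using w K by (auto simp: S_def)
          show "M \<le> glue \<kappa> (f w) + H w" using w(2) B by (simp add: Eexp[OF wS] divide_le_cancel)
        qed
        moreover have "closed {w \<in> K. exp (M / B) \<le> E w}"
          by (intro continuous_on_closed_Collect_le continuous_on_const contE compact_imp_closed K)
        moreover have "bounded {w \<in> K. exp (M / B) \<le> E w}"
          using compact_imp_bounded[OF K(1)] by (rule bounded_subset) auto
        ultimately show ?thesis by (simp add: compact_eq_bounded_closed)
      qed
    qed
    then show ?thesis by (simp add: H_def algebra_simps)
  qed
  have "glue \<kappa> (f z) + B * (ln (pole_cutoff (t z)) - 2 * ln (pseudohyp z1 z)) \<le> \<eta> / 4"
    using le_of_affine_le[OF *] .
  \<comment> \<open>Origin of the 3 in the exponent: \<open>glue\<close> lies between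
    \<open>- \<eta> / 2\<close> and \<open>\<eta> / 4\<close>, and the oscillation
    \<open>3 * \<eta> / 4\<close> is divided by \<open>B\<close>.\<close>
  then have "B * (ln (pole_cutoff (t z)) - 2 * ln (pseudohyp z1 z)) \<le> 3 * \<eta> / 4"
    using glue_ge[of \<kappa> "f z"] by linarith
  also have "3 * \<eta> / 4 = B * (3 * \<delta>^2 / d^2)" using pos d by (simp add: B_def \<kappa>_def field_simps)
  finally have "ln (pole_cutoff (t z)) - 2 * ln (pseudohyp z1 z) \<le> 3 * \<delta>^2 / d^2"
    unfolding mult_le_cancel_left_pos[OF B(1)] .
  then have "ln (pole_cutoff (t z)) \<le> 3 * \<delta>^2 / d^2 + 2 * ln (pseudohyp z1 z)" by linarith
  also have "\<dots> = ln (exp (3 * \<delta>^2 / d^2) * (pseudohyp z1 z)^2)"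
    using pd[OF zS] by (simp add: ln_mult_pos ln_realpow)
  finally have "pole_cutoff (t z) \<le> exp (3 * \<delta>^2 / d^2) * (pseudohyp z1 z)^2"
    using pole_cutoff_pos[OF tpos[OF zS]] pd[OF zS] by simp
  then show ?thesis by (simp add: t_def x_def)
qed

text \<open>On the region between the pseudohyperbolic circle of radius \<tau> about
  \<open>z1\<close> and the unit circle, \<open>glue 0\<close> along \<open>f\<close> is dominated
  by \<open>L * ln (pseudohyp z1 w)\<close>. At the origin this reads
  \<open>u (f 0) \<le> L * ln (cmod z1)\<close>, and \<open>u_ge\<close> bounds the left-hand side
  below linearly in |f 0 - p|.\<close>

lemma one_minus_cmod_le_exit:
  assumes f: "f \<in> CH (ball 0 1) \<Omega>" and z1: "cmod z1 < 1" "norm (f z1 - p) = d"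
    and f0: "norm (f 0 - p) < d / 2"
    and d: "d > 0" "8 * d \<le> c\<^sub>0 * \<eta>" "4 * d \<le> \<delta>"
    and \<tau>: "0 < \<tau>" "\<tau> < 1" "exp (3 * \<delta>^2 / d^2) * \<tau>^2 < 1 / 4"
    and \<eta>': "0 < \<eta>'" "\<eta>' \<le> \<eta> / 2" "\<And>y. y \<in> \<Omega>\<^sub>1 \<Longrightarrow> d / 2 \<le> norm (y - p) \<Longrightarrow> u y \<le> - \<eta>'"
  shows "1 - cmod z1 \<le> - ln \<tau> / (c\<^sub>0 * \<eta>') * norm (f 0 - p)"
proof -
  \<comment> \<open>Fits the comparison function to the value \<open>- \<eta>'\<close> on the inner
    circle; on the unit circle it is 0.\<close>
  define L where "L = \<eta>' / - ln \<tau>"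
  have ln\<tau>: "ln \<tau> < 0" using \<tau> by simp
  have L: "L > 0" using \<eta>' ln\<tau> unfolding L_def by (intro divide_pos_pos) auto
  have L\<tau>: "L * ln \<tau> = - \<eta>'" using ln\<tau> by (simp add: L_def)
  have harm1: "harmonic_on (ball 0 1) f" and conf1: "conformal_on (ball 0 1) f" and im: "f ` ball 0 1 \<subseteq> \<Omega>"
    using f by (auto simp: CH_def)
  have contf: "continuous_on (ball 0 1) f" by (rule harmonic_on_continuous_on[OF harm1])
  have near: "norm (f w - f z1) < d / 2" if w: "cmod w < 1" "pseudohyp z1 w \<le> \<tau>" for w
  proof -
    let ?t = "(norm (f w - f z1))^2 / d^2"
    have "min ?t 1 \<le> pole_cutoff ?t" by (rule pole_cutoff_ge_min) simp
    also have "\<dots> \<le> exp (3 * \<delta>^2 / d^2) * (pseudohyp z1 w)^2"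
      by (rule pole_cutoff_le_pseudohyp[OF f z1(1) _ d w(1)]) (use z1 in simp)
    also have "\<dots> \<le> exp (3 * \<delta>^2 / d^2) * \<tau>^2"
      using w(2) pseudohyp_nonneg by (intro mult_left_mono power_mono) auto
    finally have "min ?t 1 < 1 / 4" using \<tau>(3) by linarith
    then have "?t < 1 / 4" by linarith
    then have "(norm (f w - f z1))^2 < (d / 2)^2" using d by (simp add: field_simps)
    then show ?thesis by (rule power_less_imp_less_base) (use d in simp)
  qed
  have glue_near: "glue 0 (f w) \<le> - \<eta>'" if w: "cmod w < 1" "pseudohyp z1 w \<le> \<tau>" for w
  proof (cases "f w \<in> ball p \<delta>")
    case True
    moreover have "f w \<in> \<Omega>" using im w(1) by (simp add: image_subset_iff)
    ultimately have "f w \<in> \<Omega>\<^sub>1" using ball_Int by blast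
    moreover have "d / 2 \<le> norm (f w - p)"
      using near[OF w] z1(2) norm_triangle_ineq[of "f z1 - f w" "f w - p"] by (simp add: norm_minus_commute)
    ultimately have "u (f w) \<le> - \<eta>'" by (rule \<eta>'(3))
    then show ?thesis using True \<eta>' by (simp add: glue_def)
  qed (use \<eta>' in \<open>auto simp: glue_def\<close>)
  have glue_le_0: "glue 0 (f w) \<le> 0" if "w \<in> ball 0 1" for w
    using glue_le[OF order_refl subsetD[OF im imageI[OF that]]] by simp
  \<comment> \<open>The origin lies in the comparison region: otherwise \<open>f 0\<close> would be
    within \<open>d / 2\<close> of \<open>f z1\<close>, hence more than \<open>d / 2\<close> away
    from \<open>p\<close>.\<close>
  have pd0: "cmod z1 > \<tau>"
  proof (rule ccontr)
    assume "\<not> cmod z1 > \<tau>"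
    then have "norm (f 0 - f z1) < d / 2" by (intro near) auto
    then show False
      using f0 z1(2) norm_triangle_ineq[of "f z1 - f 0" "f 0 - p"] by (simp add: norm_minus_commute)
  qed
  define S where "S = {w \<in> ball 0 1. pseudohyp z1 w > \<tau>}"
  have "continuous_on (ball 0 1) (pseudohyp z1)"
    using continuous_on_subset[OF continuous_on_pseudohyp[OF z1(1)] ball_subset_cball] .
  then have "open (ball 0 1 \<inter> pseudohyp z1 -` {\<tau><..})"
    by (rule continuous_open_preimage) auto
  moreover have "S = ball 0 1 \<inter> pseudohyp z1 -` {\<tau><..}" by (auto simp: S_def)
  ultimately have S: "open S" by simp
  have Ssub: "S \<subseteq> ball 0 1 - {z1}" using \<tau> by (auto simp: S_def)
  have harm: "harmonic_on S f" by (rule harmonic_on_subset[OF harm1]) (use Ssub in auto)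
  have conf: "conformal_on S f"
    using conf1 Ssub unfolding conformal_on_def C1_on_def by (meson Diff_subset continuous_on_subset subset_trans subsetD)
  have fS: "f ` S \<subseteq> \<Omega>" using im Ssub by auto
  have zS: "0 \<in> S" using pd0 by (simp add: S_def)
  have *: "(glue 0 (f 0) + - L * ln (pseudohyp z1 0)) + e * 0 \<le> 0 + e * 1" if e: "0 < e" "e < 1" for e
  proof -
    define H where "H = (\<lambda>w. - L * ln (pseudohyp z1 w) + e * (cmod w)^2)"
    have harm_pd: "harmonic_on S (\<lambda>w. - L * ln (pseudohyp z1 w))"
      by (intro harmonic_on_cmult S harmonic_on_subset[OF harmonic_on_ln_pseudohyp[OF z1(1)] Ssub])
    have ls: "lower_support (0 + e * 1) H w" if "w \<in> S" for w
      unfolding H_def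
      by (intro lower_support_add lower_support_mult lower_support_cmod_power2
          lower_support_harmonic[OF S that harm_pd]) (use e in simp)
    have esq: "e * (cmod w)^2 \<le> e" if "w \<in> ball 0 1" for w
    proof -
      have "(cmod w)^2 \<le> 1" using that by (simp add: power_le_one)
      then show ?thesis using e by (simp add: mult_left_le)
    qed
    have "glue 0 (f 0) + H 0 \<le> e"
    proof (rule glue_max_principle[OF S conf harm fS _ e(1) _ _ _ _ _ zS])
      show "continuous_on S H"
        unfolding H_def by (intro continuous_intros harmonic_on_continuous_on[OF harm_pd])
      show "lower_support e (\<lambda>w. 0 * (norm (f w - p))\<^sup>2 + H w) w" "lower_support e H w" if "w \<in> S" for w
        using ls[OF that] by simp_all
      show "compact {w \<in> S. M \<le> glue 0 (f w) + H w}" if M: "e < M" for M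
      proof -
        define \<theta> where "\<theta> = exp (- ((M - e) / L))"
        have \<theta>: "\<theta> < 1" using M L by (simp add: \<theta>_def)
        define K where "K = {w \<in> {w \<in> cball 0 1. pseudohyp z1 w \<le> \<theta>}. \<tau> \<le> pseudohyp z1 w}"
        note c\<theta> = compact_pseudohyp_le[OF z1(1) \<theta>]
        have "closed K"
          unfolding K_def
          by (intro continuous_on_closed_Collect_le continuous_on_const compact_imp_closed[OF c\<theta>(1)]
              continuous_on_subset[OF continuous_on_pseudohyp[OF z1(1)]]) auto
        moreover have "bounded K" unfolding K_def by (rule bounded_subset[OF bounded_cball[of 0 1]]) auto
        ultimately have K: "compact K" "K \<subseteq> ball 0 1" "K \<subseteq> cball 0 1"
          using c\<theta>(2) by (auto simp: compact_eq_bounded_closed K_def)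
        have contW: "continuous_on K (\<lambda>w. glue 0 (f w) + H w)"
          unfolding H_def
          by (intro continuous_intros continuous_on_compose2[OF continuous_on_glue]
              continuous_on_subset[OF contf K(2)] continuous_on_subset[OF continuous_on_pseudohyp[OF z1(1)] K(3)])
             (use K im pos \<tau> in \<open>auto simp: K_def\<close>)
        have "{w \<in> S. M \<le> glue 0 (f w) + H w} = {w \<in> K. M \<le> glue 0 (f w) + H w}"
        proof safe
          fix w assume w: "w \<in> S" "M \<le> glue 0 (f w) + H w"
          then have wb: "w \<in> ball 0 1" using Ssub by auto
          have pd: "pseudohyp z1 w > \<tau>" using w by (simp add: S_def)
          have "M \<le> - L * ln (pseudohyp z1 w) + e"
            using w(2) glue_le_0[OF wb] esq[OF wb] by (simp add: H_def)
          then have "ln (pseudohyp z1 w) \<le> - ((M - e) / L)" using L by (simp add: field_simps)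
          then have "pseudohyp z1 w \<le> \<theta>"
            unfolding \<theta>_def using pd \<tau> by (simp add: ln_ge_iff flip: ln_le_cancel_iff)
          then show "w \<in> K" using pd wb by (simp add: K_def)
        next
          fix w assume w: "w \<in> K" "M \<le> glue 0 (f w) + H w"
          have wb: "w \<in> ball 0 1" using w K by blast
          \<comment> \<open>On the inner circle the sum is at most
            \<open>- \<eta>' + \<eta>' + e\<close>, below \<open>M\<close>; so closing up the region
            adds no points to the superlevel set.\<close>
          have "pseudohyp z1 w \<noteq> \<tau>"
          proof
            assume eq: "pseudohyp z1 w = \<tau>"
            then have "glue 0 (f w) \<le> - \<eta>'" using glue_near[of w] wb by simp
            then show False using w(2) esq[OF wb] M L\<tau> by (simp add: H_def eq)
          qed
          then show "w \<in> S" using w(1) wb by (simp add: S_def K_def)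
        qed
        moreover have "closed {w \<in> K. M \<le> glue 0 (f w) + H w}"
          by (intro continuous_on_closed_Collect_le continuous_on_const contW compact_imp_closed K)
        moreover have "bounded {w \<in> K. M \<le> glue 0 (f w) + H w}"
          using compact_imp_bounded[OF K(1)] by (rule bounded_subset) auto
        ultimately show ?thesis by (simp add: compact_eq_bounded_closed)
      qed
    qed (use pos in auto)
    then show ?thesis by (simp add: H_def)
  qed
  have g0: "glue 0 (f 0) \<le> L * ln (cmod z1)"
    using le_of_affine_le[OF *] by simp
  have "f 0 \<in> ball p \<delta>" using f0 d by (simp add: dist_norm norm_minus_commute)
  moreover have "f 0 \<in> \<Omega>" using im by (simp add: image_subset_iff)
  ultimately have "f 0 \<in> \<Omega>\<^sub>1" using ball_Int by blast
  have "u (f 0) \<le> L * ln (cmod z1)" "c\<^sub>0 * \<bar>u (f 0)\<bar> \<le> norm (f 0 - p)"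
    using g0 u_ge[OF \<open>f 0 \<in> \<Omega>\<^sub>1\<close>] \<open>f 0 \<in> ball p \<delta>\<close> by (auto simp: glue_def)
  moreover have "L * ln (cmod z1) \<le> L * (cmod z1 - 1)"
    using L pd0 \<tau>(1) by (intro mult_left_mono ln_le_minus_one less_imp_le[OF L]) linarith
  ultimately have "L * (1 - cmod z1) \<le> \<bar>u (f 0)\<bar>" by (simp add: algebra_simps)
  then have "c\<^sub>0 * (L * (1 - cmod z1)) \<le> c\<^sub>0 * \<bar>u (f 0)\<bar>" using pos by (intro mult_left_mono) auto
  then have "(c\<^sub>0 * L) * (1 - cmod z1) \<le> norm (f 0 - p)"
    using \<open>c\<^sub>0 * \<bar>u (f 0)\<bar> \<le> norm (f 0 - p)\<close> by (simp add: mult.assoc)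
  then have "1 - cmod z1 \<le> norm (f 0 - p) / (c\<^sub>0 * L)"
    using pos L by (simp add: pos_le_divide_eq mult.commute)
  also have "\<dots> = - ln \<tau> / (c\<^sub>0 * \<eta>') * norm (f 0 - p)"
    using ln\<tau> \<eta>' pos by (simp add: L_def field_simps)
  finally show ?thesis .
qed

text \<open>The localization estimate with \<open>z1 = 0\<close> is a Schwarz-type bound |f w - f 0|
  \<le> const |w| near 0, and differentiation along the real axis bounds the x-derivative.\<close>

lemma norm_pdx_0_le:
  assumes f: "f \<in> CH (ball 0 1) \<Omega>" and f0: "norm (f 0 - p) \<le> d"
    and d: "d > 0" "8 * d \<le> c\<^sub>0 * \<eta>" "4 * d \<le> \<delta>"
  shows "norm (pdx f 0) \<le> d * sqrt (exp (3 * \<delta>^2 / d^2))"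
proof (rule field_le_epsilon)
  fix e :: real assume e: "e > 0"
  define C where "C = exp (3 * \<delta>^2 / d^2)"
  have C: "C \<ge> 1" by (simp add: C_def)
  have part: "has_partials f (pdx f 0) (pdy f 0) 0"
    using f harmonic_onD(1)[of "ball 0 1" f 0] by (simp add: CH_def)
  \<comment> \<open>For |w| below \<open>1 / C\<close> the bound \<open>C * (cmod w)^2\<close> is
    less than 1, so the minimum with 1 is not attained by 1.\<close>
  have "\<forall>\<^sub>F w in nhds (0::complex). w \<in> ball 0 (1 / C)"
    using C by (intro eventually_nhds_in_open) auto
  with has_partials_remainder[OF part e]
  have "\<forall>\<^sub>F w in nhds 0. \<bar>Re w\<bar> * norm (pdx f 0) - \<bar>Im w\<bar> * norm (pdy f 0) \<le> (d * sqrt C + e) * cmod w"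
  proof eventually_elim
    case (elim w)
    let ?t = "(norm (f w - f 0))^2 / d^2"
    have w: "cmod w < 1 / C" using elim by simp
    also have "1 / C \<le> 1" using C by simp
    finally have w1: "cmod w < 1" .
    have "min ?t 1 \<le> pole_cutoff ?t" by (rule pole_cutoff_ge_min) simp
    also have "\<dots> \<le> C * (pseudohyp 0 w)^2"
      unfolding C_def by (rule pole_cutoff_le_pseudohyp[OF f _ f0 d w1]) simp
    finally have t: "min ?t 1 \<le> C * (cmod w)^2" by simp
    have "C * (cmod w)^2 = (C * cmod w) * cmod w" by (simp add: power2_eq_square)
    also have "\<dots> \<le> (C * cmod w) * 1" using w1 C by (intro mult_left_mono) auto
    also have "\<dots> < 1" using w C by (simp add: field_simps)
    finally have "?t \<le> C * (cmod w)^2" using t by linarith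
    then have "(norm (f w - f 0))^2 \<le> C * (cmod w)^2 * d^2"
      using d by (simp add: pos_divide_le_eq)
    also have "\<dots> = (d * sqrt C * cmod w)^2"
    proof -
      have "(sqrt C)^2 = C" using C by (intro real_sqrt_pow2) linarith
      then show ?thesis unfolding power_mult_distrib by (simp only: mult_ac)
    qed
    finally have "(norm (f w - f 0))^2 \<le> (d * sqrt C * cmod w)^2" .
    then have 1: "norm (f w - f 0) \<le> d * sqrt C * cmod w"
      by (rule power2_le_imp_le) (use d C in \<open>intro mult_nonneg_nonneg; linarith?; simp\<close>)
    have "norm (Re w *\<^sub>R pdx f 0 + Im w *\<^sub>R pdy f 0) \<le> norm (f w - f 0) + e * cmod w"
      using elim(1) norm_triangle_ineq4[of "f w - f 0" "f w - f 0 - (Re w *\<^sub>R pdx f 0 + Im w *\<^sub>R pdy f 0)"]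
      by (simp add: add.commute)
    moreover have "\<bar>Re w\<bar> * norm (pdx f 0) - \<bar>Im w\<bar> * norm (pdy f 0) \<le> norm (Re w *\<^sub>R pdx f 0 + Im w *\<^sub>R pdy f 0)"
      using norm_triangle_ineq4[of "Re w *\<^sub>R pdx f 0 + Im w *\<^sub>R pdy f 0" "Im w *\<^sub>R pdy f 0"] by simp
    ultimately show ?case using 1 by (simp add: algebra_simps)
  qed
  then obtain r where r: "r > 0" "\<And>w. cmod w < r \<Longrightarrow>
      \<bar>Re w\<bar> * norm (pdx f 0) - \<bar>Im w\<bar> * norm (pdy f 0) \<le> (d * sqrt C + e) * cmod w"
    by (auto simp: eventually_nhds_metric)
  have "(r / 2) * norm (pdx f 0) \<le> (r / 2) * (d * sqrt C + e)"
    using r(2)[of "of_real (r / 2)"] r(1) by (simp add: mult.commute)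
  then show "norm (pdx f 0) \<le> d * sqrt (exp (3 * \<delta>^2 / d^2)) + e"
    using r(1) by (simp add: C_def)
qed

end

section \<open>The minimal pseudometric\<close>

definition inverse_radii :: "'a::euclidean_space set \<Rightarrow> 'a \<Rightarrow> 'a \<Rightarrow> real set" where
  "inverse_radii \<Omega> x v = {1 / r | r. 1 / r > 0 \<and> (\<exists>f \<in> CH (ball 0 1) \<Omega>. f 0 = x \<and> pdx f 0 = r *\<^sub>R v)}"

lemma minimal_pseudometric_eq_Inf: "minimal_pseudometric \<Omega> x v = Inf (inverse_radii \<Omega> x v)"
  by (simp add: minimal_pseudometric_def inverse_radii_def)

lemma bdd_below_inverse_radii: "bdd_below (inverse_radii \<Omega> x v)"
  by (rule bdd_belowI[of _ 0]) (auto simp: inverse_radii_def)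

text \<open>A small flat disc spanned by \<open>v\<close> and an orthogonal vector of the same
  length is a competitor. Nonemptiness is what makes the real infimum meaningful.\<close>

lemma inverse_radii_nonempty:
  fixes \<Omega> :: "'a::euclidean_space set"
  assumes "2 \<le> DIM('a)" "open \<Omega>" "x \<in> \<Omega>"
  shows "inverse_radii \<Omega> x v \<noteq> {}"
proof -
  obtain e where e: "norm e = norm v" "v \<bullet> e = 0"
  proof -
    obtain y where y: "y \<noteq> 0" "orthogonal v y" using orthogonal_to_vector_exists[OF assms(1)] .
    show thesis using y by (intro that[of "(norm v / norm y) *\<^sub>R y"]) (auto simp: orthogonal_def)
  qed
  obtain \<rho> where \<rho>: "\<rho> > 0" "ball x \<rho> \<subseteq> \<Omega>" using assms openE by blast
  \<comment> \<open>The summand 1 covers \<open>v = 0\<close>; the factor 2 accounts for the two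
    spanning vectors.\<close>
  define r where "r = \<rho> / (2 * norm v + 1)"
  have r: "r > 0" using \<rho> by (simp add: r_def add_nonneg_pos)
  define f where "f = (\<lambda>z. x + (Re z *\<^sub>R (r *\<^sub>R v) + Im z *\<^sub>R (r *\<^sub>R e)))"
  have part: "has_partials f (r *\<^sub>R v) (r *\<^sub>R e) z" for z
  proof -
    have "(f has_derivative (\<lambda>z. Re z *\<^sub>R (r *\<^sub>R v) + Im z *\<^sub>R (r *\<^sub>R e))) (at z)"
      unfolding f_def by (rule has_derivative_eq_rhs, (rule derivative_intros)+) simp
    then show ?thesis by (simp add: has_partials_def)
  qed
  have harm: "harmonic_on (ball 0 1) f"
    by (rule harmonic_onI[OF open_ball part has_partials_const has_partials_const]) auto
  have C1: "C1_on (ball 0 1) f" using harm by (simp add: harmonic_on_def C2_on_def)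
  have conf: "conformal_on (ball 0 1) f"
    using C1 e has_partials_eq(2,3)[OF part] by (simp add: conformal_on_def)
  have "f z \<in> \<Omega>" if "z \<in> ball 0 1" for z
  proof -
    have "norm (f z - x) \<le> (norm (r *\<^sub>R v) + norm (r *\<^sub>R e)) * cmod z"
      unfolding f_def using norm_partials_le[of z "r *\<^sub>R v" "r *\<^sub>R e"] by simp
    also have "\<dots> \<le> (norm (r *\<^sub>R v) + norm (r *\<^sub>R e)) * 1"
      using that by (intro mult_left_mono) auto
    also have "\<dots> = r * (2 * norm v)" using e r by simp
    also have "\<dots> < r * (2 * norm v + 1)" using r by simp
    also have "\<dots> = \<rho>" unfolding r_def by (intro nonzero_eq_divide_eq[THEN iffD1, OF _ refl]) (smt (verit) norm_ge_zero)
    finally show ?thesis using \<rho> by (auto simp: dist_norm norm_minus_commute)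
  qed
  then have "f \<in> CH (ball 0 1) \<Omega>" using harm conf by (auto simp: CH_def)
  moreover have "f 0 = x" "pdx f 0 = r *\<^sub>R v" using has_partials_eq(2)[OF part] by (auto simp: f_def)
  ultimately have "1 / r \<in> inverse_radii \<Omega> x v" using r unfolding inverse_radii_def by fastforce
  then show ?thesis by blast
qed

lemma minimal_pseudometric_nonneg:
  fixes \<Omega> :: "'a::euclidean_space set"
  assumes "2 \<le> DIM('a)" "open \<Omega>" "x \<in> \<Omega>"
  shows "minimal_pseudometric \<Omega> x v \<ge> 0"
  unfolding minimal_pseudometric_eq_Inf
  by (rule cInf_greatest[OF inverse_radii_nonempty[OF assms]]) (auto simp: inverse_radii_def)

lemma minimal_pseudometric_scale_le:
  fixes \<Omega> :: "'a::euclidean_space set"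
  assumes "2 \<le> DIM('a)" "open \<Omega>" "x \<in> \<Omega>" and s: "0 < s" "s \<le> 1"
    and im: "\<And>f. f \<in> CH (ball 0 1) \<Omega> \<Longrightarrow> f 0 = x \<Longrightarrow> f ` ball 0 s \<subseteq> \<Omega>'"
  shows "s * minimal_pseudometric \<Omega>' x v \<le> minimal_pseudometric \<Omega> x v"
  unfolding minimal_pseudometric_eq_Inf[of \<Omega>]
proof (rule cInf_greatest[OF inverse_radii_nonempty[OF assms(1-3)]])
  fix q assume "q \<in> inverse_radii \<Omega> x v"
  then obtain r f where r: "q = 1 / r" "1 / r > 0" and f: "f \<in> CH (ball 0 1) \<Omega>" "f 0 = x" "pdx f 0 = r *\<^sub>R v"
    by (auto simp: inverse_radii_def)
  let ?g = "\<lambda>z. f (s *\<^sub>R z)"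
  have "?g \<in> CH (ball 0 1) \<Omega>'" "pdx ?g 0 = (s * r) *\<^sub>R v"
    using CH_scale[OF f(1) s im[OF f(1,2)]] f(3) by auto
  moreover have "?g 0 = x" using f by simp
  moreover have "1 / (s * r) > 0" using s r by simp
  ultimately have "1 / (s * r) \<in> inverse_radii \<Omega>' x v"
    unfolding inverse_radii_def by (intro CollectI exI[of _ "s * r"] conjI refl bexI[of _ ?g])
  then have "minimal_pseudometric \<Omega>' x v \<le> 1 / (s * r)"
    unfolding minimal_pseudometric_eq_Inf by (rule cInf_lower[OF _ bdd_below_inverse_radii])
  then have "s * minimal_pseudometric \<Omega>' x v \<le> s * (1 / (s * r))" using s by (intro mult_left_mono) auto
  then show "s * minimal_pseudometric \<Omega>' x v \<le> q" using s r by simp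
qed

lemma minimal_pseudometric_ge:
  fixes \<Omega> :: "'a::euclidean_space set"
  assumes "2 \<le> DIM('a)" "open \<Omega>" "x \<in> \<Omega>" and K: "K > 0"
    and le: "\<And>f. f \<in> CH (ball 0 1) \<Omega> \<Longrightarrow> f 0 = x \<Longrightarrow> norm (pdx f 0) \<le> K"
  shows "1 / K * norm v \<le> minimal_pseudometric \<Omega> x v"
  unfolding minimal_pseudometric_eq_Inf
proof (rule cInf_greatest[OF inverse_radii_nonempty[OF assms(1-3)]])
  fix q assume "q \<in> inverse_radii \<Omega> x v"
  then obtain r f where r: "q = 1 / r" "1 / r > 0" and f: "f \<in> CH (ball 0 1) \<Omega>" "f 0 = x" "pdx f 0 = r *\<^sub>R v"
    by (auto simp: inverse_radii_def)
  then have "r * norm v \<le> K" using le[OF f(1,2)] by simp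
  moreover have "r > 0" using r by simp
  ultimately have "norm v / K \<le> 1 / r" using K by (simp add: pos_divide_le_eq pos_le_divide_eq mult.commute)
  then show "1 / K * norm v \<le> q" by (simp add: r(1))
qed

section \<open>Uniform constants and the comparison of the two pseudometrics\<close>

theorem theorem8p5:
  fixes \<Omega> \<Omega>\<^sub>1 \<omega> :: "(real ^ 'n) set" and \<delta> c\<^sub>0 :: real and \<phi> :: "real \<Rightarrow> real"
  assumes "CARD('n) \<ge> 3"
    and "is_domain \<Omega>" and "is_domain \<Omega>\<^sub>1" and "\<Omega>\<^sub>1 \<subseteq> \<Omega>" and "compact (closure \<Omega>\<^sub>1)"
    and "\<omega> \<noteq> {}" and "\<omega> \<subseteq> frontier \<Omega> \<inter> frontier \<Omega>\<^sub>1"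
    and "\<delta> > 0" and "\<forall>p\<in>\<omega>. ball p \<delta> \<inter> \<Omega> \<subseteq> \<Omega>\<^sub>1"
    and "c\<^sub>0 > 0"
    and "continuous_on {0..} \<phi>" and "mono_on {0..} \<phi>" and "\<phi> ` {0..} \<subseteq> {0..}" and "\<phi> 0 = 0"
    and "\<forall>p\<in>\<omega>. \<exists>u :: real ^ 'n \<Rightarrow> real.
           continuous_on (closure \<Omega>\<^sub>1) u \<and> u ` closure \<Omega>\<^sub>1 \<subseteq> {..0} \<and>
           MPSH_on \<Omega>\<^sub>1 (\<lambda>x. ereal (u x)) \<and>
           u p = 0 \<and> (\<forall>x \<in> closure \<Omega>\<^sub>1 - {p}. u x < 0) \<and>
           (\<forall>x\<in>\<Omega>\<^sub>1. c\<^sub>0 * \<bar>u x\<bar> \<le> norm (x - p) \<and> norm (x - p) \<le> \<phi> \<bar>u x\<bar>)"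
  shows "(\<exists>c>0. \<forall>x\<in>\<Omega>\<^sub>1. \<forall>v. minimal_pseudometric \<Omega> x v
              \<ge> (1 - c * infdist x \<omega>) * minimal_pseudometric \<Omega>\<^sub>1 x v) \<and>
         (\<exists>\<epsilon>>0. \<forall>x\<in>\<Omega>. infdist x \<omega> < \<epsilon> \<longrightarrow> hyperbolic_at \<Omega> x)"
proof -
  have dim: "2 \<le> DIM(real ^ 'n)" using assms(1) by simp
  have opens: "open \<Omega>" "open \<Omega>\<^sub>1" using assms(2,3) by (auto simp: is_domain_def)
  have \<phi>_small: "\<exists>\<eta>>0. \<forall>t\<ge>0. t < \<eta> \<longrightarrow> \<phi> t < s" if "s > 0" for s
  proof -
    have "\<exists>\<eta>>0. \<forall>t\<in>{0..}. dist t 0 < \<eta> \<longrightarrow> dist (\<phi> t) (\<phi> 0) < s"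
      by (rule assms(11)[unfolded continuous_on_iff, THEN bspec, THEN spec, THEN mp]) (use that in auto)
    then obtain \<eta> where \<eta>: "\<eta> > 0" "\<forall>t\<in>{0..}. dist t 0 < \<eta> \<longrightarrow> dist (\<phi> t) (\<phi> 0) < s"
      by blast
    have "\<phi> t < s" if "t \<ge> 0" "t < \<eta>" for t
      using \<eta>(2)[rule_format, of t] that assms(14) by (simp add: dist_real_def)
    with \<eta>(1) show ?thesis by blast
  qed
  obtain \<eta> where \<eta>: "\<eta> > 0" "\<And>t. t \<ge> 0 \<Longrightarrow> t < \<eta> \<Longrightarrow> \<phi> t < \<delta> / 2"
    using \<phi>_small[of "\<delta> / 2"] assms(8) by auto
  \<comment> \<open>The radius required by \<open>glue_gt\<close>, independent of the point of
    \<omega>.\<close>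
  define d where "d = min (c\<^sub>0 * \<eta> / 8) (\<delta> / 4)"
  have d: "d > 0" "8 * d \<le> c\<^sub>0 * \<eta>" "4 * d \<le> \<delta>" using \<eta> assms(8,10) by (auto simp: d_def)
  obtain \<eta>2 where \<eta>2: "\<eta>2 > 0" "\<And>t. t \<ge> 0 \<Longrightarrow> t < \<eta>2 \<Longrightarrow> \<phi> t < d / 2"
    using \<phi>_small[of "d / 2"] d by auto
  \<comment> \<open>\<open>\<eta>2\<close> bounds \<open>u\<close> at distance at least
    \<open>d / 2\<close>; the cap \<open>\<eta> / 2\<close> keeps the bound valid for the floor of
    the glued function.\<close>
  define \<eta>' where "\<eta>' = min \<eta>2 (\<eta> / 2)"
  have \<eta>': "0 < \<eta>'" "\<eta>' \<le> \<eta> / 2" "\<eta>' \<le> \<eta>2" using \<eta> \<eta>2 by (auto simp: \<eta>'_def)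
  have peak: "\<exists>u. local_peak_function \<Omega> \<Omega>\<^sub>1 p u \<delta> \<eta> c\<^sub>0 \<and>
      (\<forall>y\<in>\<Omega>\<^sub>1. d / 2 \<le> norm (y - p) \<longrightarrow> u y \<le> - \<eta>')" if p: "p \<in> \<omega>" for p
  proof -
    obtain u where u: "continuous_on (closure \<Omega>\<^sub>1) u" "u ` closure \<Omega>\<^sub>1 \<subseteq> {..0}"
      "MPSH_on \<Omega>\<^sub>1 (\<lambda>x. ereal (u x))"
      "\<And>x. x \<in> \<Omega>\<^sub>1 \<Longrightarrow> c\<^sub>0 * \<bar>u x\<bar> \<le> norm (x - p) \<and> norm (x - p) \<le> \<phi> \<bar>u x\<bar>"
      using assms(15) p by meson
    have u0: "u y \<le> 0" if "y \<in> \<Omega>\<^sub>1" for y using u(2) that closure_subset by auto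
    \<comment> \<open>Contrapositive of the upper bound by \<phi>: a value of \<open>u\<close> too
      close to 0 would force the point too close to \<open>p\<close>.\<close>
    have far: "u y \<le> - h" if "y \<in> \<Omega>\<^sub>1" "s \<le> norm (y - p)" "\<And>t. t \<ge> 0 \<Longrightarrow> t < h \<Longrightarrow> \<phi> t < s" for y s h
    proof -
      have "\<not> \<phi> \<bar>u y\<bar> < s" using u(4)[OF that(1)] that(2) by linarith
      then have "\<not> \<bar>u y\<bar> < h" using that(3)[of "\<bar>u y\<bar>"] by auto
      then show ?thesis using u0[OF that(1)] by linarith
    qed
    have "local_peak_function \<Omega> \<Omega>\<^sub>1 p u \<delta> \<eta> c\<^sub>0"
      using opens assms(8-10) p \<eta> u u0 far[of _ "\<delta> / 2" \<eta>] continuous_on_subset[OF u(1) closure_subset]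
      by unfold_locales auto
    moreover have "u y \<le> - \<eta>'" if "y \<in> \<Omega>\<^sub>1" "d / 2 \<le> norm (y - p)" for y
      using far[OF that, of \<eta>2] \<eta>2(2) \<eta>'(3) by fastforce
    ultimately show ?thesis by blast
  qed
  have close: "\<exists>p\<in>\<omega>. norm (x - p) < s" if "infdist x \<omega> < s" for x s
  proof -
    have "\<exists>q\<in>dist x ` \<omega>. q < s"
      using that assms(6) by (intro cInf_lessD) (auto simp: infdist_notempty)
    then show ?thesis by (auto simp: dist_norm)
  qed
  \<comment> \<open>Makes \<open>exp (3 * \<delta>^2 / d^2) * \<tau>^2\<close> equal to 1/9. Any
    value below 1/4 keeps the image of the pseudohyperbolic disc within \<open>d / 2\<close> of its
    centre.\<close>
  define \<tau> where "\<tau> = exp (- (3 * \<delta>^2 / d^2) / 2) / 3"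
  have \<tau>: "0 < \<tau>" "\<tau> < 1" "exp (3 * \<delta>^2 / d^2) * \<tau>^2 < 1 / 4"
  proof -
    have "exp (- (3 * \<delta>^2 / d^2) / 2) \<le> 1" by simp
    then show "\<tau> < 1" unfolding \<tau>_def by linarith
    have "(exp (- (3 * \<delta>^2 / d^2) / 2))^2 = exp (- (3 * \<delta>^2 / d^2))"
      by (simp flip: exp_double)
    then have "exp (3 * \<delta>^2 / d^2) * \<tau>^2 = 1 / 9"
      by (simp add: \<tau>_def power_divide flip: exp_add)
    then show "exp (3 * \<delta>^2 / d^2) * \<tau>^2 < 1 / 4" by simp
  qed (simp add: \<tau>_def)
  define A where "A = - ln \<tau> / (c\<^sub>0 * \<eta>')"
  have A: "A > 0" using \<tau> \<eta>' assms(10) unfolding A_def by (intro divide_pos_pos) auto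
  \<comment> \<open>With \<open>4 / d\<close> the claim is trivial unless dist (x, \<omega>) is
    below \<open>d / 4\<close>; \<open>2 * A\<close> absorbs the factor 2 lost in choosing a nearly
    closest point.\<close>
  define c where "c = max (4 / d) (2 * A)"
  have c: "c > 0" "4 / d \<le> c" "2 * A \<le> c" using d by (auto simp: c_def less_max_iff_disj)
  have "(1 - c * infdist x \<omega>) * minimal_pseudometric \<Omega>\<^sub>1 x v \<le> minimal_pseudometric \<Omega> x v"
    if x: "x \<in> \<Omega>\<^sub>1" for x v
  proof (cases "1 - c * infdist x \<omega> \<le> 0")
    case True
    have "minimal_pseudometric \<Omega>\<^sub>1 x v \<ge> 0" "minimal_pseudometric \<Omega> x v \<ge> 0"
      using minimal_pseudometric_nonneg[OF dim] opens x assms(4) by auto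
    then show ?thesis using mult_nonpos_nonneg[OF True] by (meson order_trans)
  next
    case False
    define s where "s = 1 - c * infdist x \<omega>"
    have xO: "x \<in> \<Omega>" using x assms(4) by auto
    have "closure \<omega> \<subseteq> frontier \<Omega>"
      using assms(7) by (intro closure_minimal) (auto simp: frontier_closed)
    \<comment> \<open>Positivity of the distance allows a point of \<omega> within twice that
      distance; \<omega> need not be closed, so a closest point may fail to exist.\<close>
    then have "x \<notin> closure \<omega>"
      using xO opens(1) by (auto simp: frontier_def interior_open)
    then have dist_pos: "infdist x \<omega> > 0"
      using in_closure_iff_infdist_zero[OF assms(6)] infdist_nonneg[of x \<omega>] by (simp add: less_le)
    have s: "0 < s" "s \<le> 1" using False c dist_pos by (auto simp: s_def)
    have "4 / d * infdist x \<omega> \<le> c * infdist x \<omega>" using c dist_pos by (intro mult_right_mono) auto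
    then have "4 / d * infdist x \<omega> < 1" using False by linarith
    then have small: "2 * infdist x \<omega> < d / 2" using d by (simp add: field_simps)
    obtain p where p: "p \<in> \<omega>" "norm (x - p) < 2 * infdist x \<omega>" using close[of x "2 * infdist x \<omega>"] dist_pos by auto
    obtain u where u: "local_peak_function \<Omega> \<Omega>\<^sub>1 p u \<delta> \<eta> c\<^sub>0"
      "\<And>y. y \<in> \<Omega>\<^sub>1 \<Longrightarrow> d / 2 \<le> norm (y - p) \<Longrightarrow> u y \<le> - \<eta>'"
      using peak[OF p(1)] by blast
    interpret local_peak_function \<Omega> \<Omega>\<^sub>1 p u \<delta> \<eta> c\<^sub>0 by (rule u(1))
    have "f ` ball 0 s \<subseteq> \<Omega>\<^sub>1" if f: "f \<in> CH (ball 0 1) \<Omega>" "f 0 = x" for f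
    proof -
      have sub: "ball 0 s \<subseteq> ball (0::complex) 1" using s by auto
      have cont: "continuous_on (ball 0 s) f"
        using f sub harmonic_on_continuous_on continuous_on_subset unfolding CH_def by blast
      have f0: "norm (f 0 - p) < d / 2" using p small f(2) by simp
      have "norm (f z - p) < d" if z: "z \<in> ball 0 s" for z
      proof (rule ccontr)
        assume "\<not> norm (f z - p) < d"
        moreover have "connected ((\<lambda>z. norm (f z - p)) ` ball 0 s)"
          by (intro connected_continuous_image continuous_intros cont) simp
        moreover have "norm (f 0 - p) \<in> (\<lambda>z. norm (f z - p)) ` ball 0 s" "norm (f z - p) \<in> (\<lambda>z. norm (f z - p)) ` ball 0 s"
          using z s by auto
        \<comment> \<open>A disc that leaves the ball passes through distance exactly
          \<open>d\<close>, by connectedness. There the exit estimate gives 1 - |z1| \<le> 1 - s,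
          although |z1| < s.\<close>
        ultimately have "d \<in> (\<lambda>z. norm (f z - p)) ` ball 0 s"
          using f0 d by (intro connectedD_interval[of _ "norm (f 0 - p)" "norm (f z - p)" d]) auto
        then obtain z1 where z1: "z1 \<in> ball 0 s" "norm (f z1 - p) = d" by auto
        have "1 - cmod z1 \<le> A * norm (f 0 - p)"
          unfolding A_def
          by (rule one_minus_cmod_le_exit[OF f(1) _ z1(2) f0 d \<tau> \<eta>'(1,2) u(2)]) (use z1 s in auto)
        also have "\<dots> \<le> A * (2 * infdist x \<omega>)" using A p f(2) by (intro mult_left_mono) auto
        also have "\<dots> \<le> c * infdist x \<omega>" using mult_right_mono[OF c(3) less_imp_le[OF dist_pos]] by simp
        finally show False using z1(1) by (simp add: s_def)
      qed
      moreover have "f z \<in> \<Omega>" if "z \<in> ball 0 s" for z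
        using f(1) subsetD[OF sub that] by (auto simp: CH_def image_subset_iff)
      ultimately have "f z \<in> ball p \<delta> \<inter> \<Omega>" if "z \<in> ball 0 s" for z
        using that d by (force simp: dist_norm norm_minus_commute)
      then show ?thesis using ball_Int by blast
    qed
    then show ?thesis
      using minimal_pseudometric_scale_le[OF dim opens(1) xO s] by (simp add: s_def)
  qed
  moreover have "hyperbolic_at \<Omega> x" if x: "x \<in> \<Omega>" "infdist x \<omega> < d" for x
  proof -
    define K where "K = d * sqrt (exp (3 * \<delta>^2 / d^2))"
    have K: "K > 0" using d by (simp add: K_def)
    have bound: "1 / K * norm v \<le> minimal_pseudometric \<Omega> y v" if y: "y \<in> \<Omega>" "infdist y \<omega> < d" for y v
    proof (rule minimal_pseudometric_ge[OF dim opens(1) y(1) K])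
      fix f assume f: "f \<in> CH (ball 0 1) \<Omega>" "f 0 = y"
      obtain p where p: "p \<in> \<omega>" "norm (y - p) < d" using close[OF y(2)] by blast
      obtain u where u: "local_peak_function \<Omega> \<Omega>\<^sub>1 p u \<delta> \<eta> c\<^sub>0" using peak[OF p(1)] by blast
      show "norm (pdx f 0) \<le> K"
        unfolding K_def
        by (rule local_peak_function.norm_pdx_0_le[OF u f(1) _ d]) (use p f in simp)
    qed
    \<comment> \<open>This neighbourhood works for every such \<open>x\<close> at once, with the
      single constant \<open>1 / K\<close>.\<close>
    have "open (\<Omega> \<inter> {y. infdist y \<omega> < d})"
      by (intro open_Int opens open_Collect_less continuous_intros)
    then show ?thesis
      unfolding hyperbolic_at_def using x bound K
      by (intro exI[of _ "\<Omega> \<inter> {y. infdist y \<omega> < d}"] exI[of _ "1 / K"]) auto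
  qed
  ultimately show ?thesis using c(1) d(1) by blast
qed

end
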